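(* The set of all $f\in\mathbb{N}^\mathbb{N}$ that name a presentation of $\ell^2$ is $\Pi^0_2$-complete, and for each $n\ge 1$ the set of all $f\in\mathbb{N}^\mathbb{N}$ that name a presentation of $\ell^2_n$ is $\Pi^0_2$-complete.
   Context: The scalar field $\mathbb{F}$ is $\mathbb{R}$ or $\mathbb{C}$; $\mathbb{F}_\mathbb{Q}=\mathbb{F}\cap\mathbb{Q}(i)$. A presentation of a Banach space $\mathcal{B}$ is a pair $(\mathcal{B},R)$ with $R:\mathbb{N}\to\mathcal{B}$ having linearly dense range. Its rational vectors are the finite $\mathbb{F}_\mathbb{Q}$-linear combinations of the $R(n)$, coded via a fixed Gödel numbering of formal expressions. With $I_n$ the $n$-th rational open interval in a fixed effective enumeration, the diagram is the set of codes of pairs $(m,n)$ with the norm of the $m$-th rational vector in $I_n$. A name of the presentation is any $f\in\mathbb{N}^\mathbb{N}$ whose range is its diagram; $f$ names a presentation of $X$ if it names a presentation of a space isometrically isomorphic to $X$. $\ell^2_n$ is $\mathbb{F}^n$ with the Euclidean norm. A set $S\subseteq\mathbb{N}^\mathbb{N}$ is $\Pi^0_2$-complete if it is (lightface) $\Pi^0_2$ and for every $\Pi^0_2$ set $P\subseteq\mathbb{N}^\mathbb{N}$ there is a computable operator $F$ with $P(f)\iff F(f)\in S$. *)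

theory Defs
  imports Complex_Main "HOL-Library.Nat_Bijection"
begin

text \<open>Kleene's mu-recursive functions; a function of arity n is modelled as a
  function on nat lists, only its values on lists of length n matter.\<close>

inductive recfn :: "nat \<Rightarrow> (nat list \<Rightarrow> nat) \<Rightarrow> bool" where
  zero: "recfn n (\<lambda>_. 0)"
| succ: "recfn 1 (\<lambda>xs. Suc (hd xs))"
| proj: "i < n \<Longrightarrow> recfn n (\<lambda>xs. xs ! i)"
| comp: "recfn m g \<Longrightarrow> length fs = m \<Longrightarrow> (\<forall>f\<in>set fs. recfn n f)
          \<Longrightarrow> recfn n (\<lambda>xs. g (map (\<lambda>f. f xs) fs))"
| prim: "recfn n g \<Longrightarrow> recfn (Suc (Suc n)) h
          \<Longrightarrow> recfn (Suc n) (\<lambda>xs. rec_nat (g (tl xs)) (\<lambda>y r. h (y # r # tl xs)) (hd xs))"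
| mu: "recfn (Suc n) g \<Longrightarrow> (\<forall>xs. length xs = n \<longrightarrow> (\<exists>y. g (y # xs) = 0))
          \<Longrightarrow> recfn n (\<lambda>xs. LEAST y. g (y # xs) = 0)"

definition computable :: "(nat \<Rightarrow> nat) \<Rightarrow> bool" where
  "computable g \<longleftrightarrow> (\<exists>f. recfn 1 f \<and> (\<forall>x. g x = f [x]))"

definition init_code :: "(nat \<Rightarrow> nat) \<Rightarrow> nat \<Rightarrow> nat" where
  "init_code f k = list_encode (map f [0..<k])"

definition Pi02 :: "(nat \<Rightarrow> nat) set \<Rightarrow> bool" where
  "Pi02 S \<longleftrightarrow> (\<exists>R. computable R \<and>
     (\<forall>f. f \<in> S \<longleftrightarrow> (\<forall>a. \<exists>b. R (prod_encode (a, init_code f b)) \<noteq> 0)))"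

text \<open>Computable (total) operators on Baire space: F f n is read off from the
  shortest initial segment of f on which the computable e halts (is nonzero).\<close>
definition computable_operator :: "((nat \<Rightarrow> nat) \<Rightarrow> (nat \<Rightarrow> nat)) \<Rightarrow> bool" where
  "computable_operator F \<longleftrightarrow> (\<exists>e. computable e \<and>
     (\<forall>f n. (\<exists>k. e (prod_encode (n, init_code f k)) \<noteq> 0) \<and>
            F f n = e (prod_encode (n, init_code f (LEAST k. e (prod_encode (n, init_code f k)) \<noteq> 0))) - 1))"

definition Pi02_complete :: "(nat \<Rightarrow> nat) set \<Rightarrow> bool" where
  "Pi02_complete S \<longleftrightarrow> Pi02 S \<and>
     (\<forall>P. Pi02 P \<longrightarrow> (\<exists>F. computable_operator F \<and> (\<forall>f. f \<in> P \<longleftrightarrow> F f \<in> S)))"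

definition ell2 :: "(nat \<Rightarrow> 'a::real_normed_field) set" where
  "ell2 = {x. summable (\<lambda>i. (norm (x i))\<^sup>2)}"

definition ell2_norm :: "(nat \<Rightarrow> 'a::real_normed_field) \<Rightarrow> real" where
  "ell2_norm x = sqrt (\<Sum>i. (norm (x i))\<^sup>2)"

text \<open>ell^2_n: F^n with the Euclidean norm, realised as sequences vanishing from n on.\<close>
definition ell2n :: "nat \<Rightarrow> (nat \<Rightarrow> 'a::real_normed_field) set" where
  "ell2n n = {x. \<forall>i\<ge>n. x i = 0}"

definition presentation :: "(nat \<Rightarrow> 'a::real_normed_field) set \<Rightarrow> (nat \<Rightarrow> nat \<Rightarrow> 'a) \<Rightarrow> bool" where
  "presentation X R \<longleftrightarrow> (\<forall>j. R j \<in> X) \<and>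
     (\<forall>x\<in>X. \<forall>\<epsilon>>0. \<exists>cs::('a \<times> nat) list.
        ell2_norm (\<lambda>k. x k - (\<Sum>(c,i)\<leftarrow>cs. c * R i k)) < \<epsilon>)"

definition rat_dec :: "nat \<Rightarrow> real" where
  "rat_dec c = (case prod_decode c of (p, q) \<Rightarrow> of_int (int_decode p) / of_nat (Suc q))"

definition crat_dec :: "nat \<Rightarrow> complex" where
  "crat_dec c = (case prod_decode c of (a, b) \<Rightarrow> Complex (rat_dec a) (rat_dec b))"

definition rat_vec :: "(nat \<Rightarrow> 'a::real_normed_field) \<Rightarrow> (nat \<Rightarrow> nat \<Rightarrow> 'a) \<Rightarrow> nat \<Rightarrow> nat \<Rightarrow> 'a" where
  "rat_vec dec R m = (\<lambda>k. \<Sum>(c,i)\<leftarrow>map prod_decode (list_decode m). dec c * R i k)"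

definition rat_interval :: "nat \<Rightarrow> real set" where
  "rat_interval n = (case prod_decode n of (a, b) \<Rightarrow> {rat_dec a <..< rat_dec b})"

definition diagram :: "(nat \<Rightarrow> 'a::real_normed_field) \<Rightarrow> (nat \<Rightarrow> nat \<Rightarrow> 'a) \<Rightarrow> nat set" where
  "diagram dec R = {prod_encode (m, n) | m n. ell2_norm (rat_vec dec R m) \<in> rat_interval n}"

text \<open>f names a presentation of X (up to isometric isomorphism, transported to X itself).\<close>
definition names_presentation_of ::
  "(nat \<Rightarrow> 'a::real_normed_field) \<Rightarrow> (nat \<Rightarrow> 'a) set \<Rightarrow> (nat \<Rightarrow> nat) \<Rightarrow> bool" where
  "names_presentation_of dec X f \<longleftrightarrow> (\<exists>R. presentation X R \<and> range f = diagram dec R)"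

end

theory Submission
  imports Defs "HOL-Analysis.Analysis" "HOL-Library.Diagonal_Subsequence"
begin

text \<open>
  A function \<open>f\<close> names a presentation of \<open>\<ell>\<^sup>2\<close> (or \<open>\<ell>\<^sup>2\<^sub>n\<close>) iff its range describes a family of real numbers,
  these numbers are the norms of a Hilbert space presentation, and the space has the right dimension.
  By Gram-Schmidt every presentation has an isometric copy \<open>R\<close> that is triangular: \<open>R i\<close> lies in the span
  of the first \<open>i + 1\<close> unit vectors. Coordinatewise compactness of bounded triangular arrays therefore turns ``the
  numbers are norms of a presentation'' into: for every \<open>M\<close> there is a rational triangular array satisfying
  the first \<open>M\<close> constraints listed by \<open>f\<close>. That the dimension is at least \<open>d\<close> is the open condition that some
  \<open>D + 1\<close> rational vectors have pairwise negative real inner products, \<open>D\<close> being the real dimension of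
  \<open>d\<close>-dimensional space; this is expressible by norms as \<open>\<parallel>u + v\<parallel>\<^sup>2 < \<parallel>u\<parallel>\<^sup>2 + \<parallel>v\<parallel>\<^sup>2\<close>. All conditions are \<open>\<Pi>\<^sup>0\<^sub>2\<close>.

  For hardness, fix a computable name of the space and copy its values only as long as the given
  \<open>\<Pi>\<^sup>0\<^sub>2\<close> condition keeps being confirmed: if the condition fails, the resulting range is finite, but
  a diagram is infinite.
\<close>

section \<open>Closure properties of computable functions\<close>

text \<open>That a presentation exists is a quantifier over infinite sequences of vectors. It
  becomes arithmetical because the triangular arrays obeying the bounds listed by \<open>f\<close>
  form a compact set. Triangularity is what makes compactness usable: a rational vector then
  involves finitely many coordinates, known in advance, so its norm is continuous in the entries.
  Coordinatewise limits of general square-summable rows can lose norm.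

  Passing to a limit still does two kinds of damage. Strict inequalities become weak, which is
  repaired by requiring every listed interval to have a listed interval for the same vector strictly
  inside it. And the limit vectors may span a space of smaller dimension, so the lower bound on the
  dimension is a separate condition, stated so that finitely many values of \<open>f\<close> can
  confirm it. Obtuseness suits this because it is a strict inequality between norms that involves
  only the real part of the inner product, so one argument serves both scalar fields. The upper
  bound on the dimension is built into the arrays: their columns range over an initial segment
  \<open>J\<close> of the natural numbers, which is everything for the infinite-dimensional
  space.\<close>

definition recfn_on :: "nat \<Rightarrow> (nat list \<Rightarrow> nat) \<Rightarrow> bool" where
  "recfn_on n F \<longleftrightarrow> (\<exists>f. recfn n f \<and> (\<forall>xs. length xs = n \<longrightarrow> F xs = f xs))"

lemma recfn_onI: "recfn n f \<Longrightarrow> (\<And>xs. length xs = n \<Longrightarrow> F xs = f xs) \<Longrightarrow> recfn_on n F"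
  unfolding recfn_on_def by blast

text \<open>\<open>recfn\<close> depends on the values at lists of every length. Invariance under
  changes at irrelevant lists allows each closure property below to be proved by exhibiting a
  recursion with the same relevant values.\<close>

lemma recfn_on_cong: "recfn_on n F \<Longrightarrow> (\<And>xs. length xs = n \<Longrightarrow> G xs = F xs) \<Longrightarrow> recfn_on n G"
  unfolding recfn_on_def by metis

lemma recfn_on_proj: "i < n \<Longrightarrow> recfn_on n (\<lambda>xs. xs ! i)"
  by (rule recfn_onI[OF recfn.proj]) auto

lemma recfn_on_comp:
  assumes "recfn_on m G" "length Fs = m" "\<And>F. F \<in> set Fs \<Longrightarrow> recfn_on n F"
  shows "recfn_on n (\<lambda>xs. G (map (\<lambda>F. F xs) Fs))"
proof -
  obtain g where g: "recfn m g" "\<And>xs. length xs = m \<Longrightarrow> G xs = g xs"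
    using assms(1) unfolding recfn_on_def by blast
  have "\<forall>F\<in>set Fs. \<exists>f. recfn n f \<and> (\<forall>xs. length xs = n \<longrightarrow> F xs = f xs)"
    using assms(3) unfolding recfn_on_def by blast
  then obtain \<phi> where \<phi>: "\<And>F. F \<in> set Fs \<Longrightarrow> recfn n (\<phi> F)"
    "\<And>F xs. F \<in> set Fs \<Longrightarrow> length xs = n \<Longrightarrow> F xs = \<phi> F xs" by metis
  show ?thesis
  proof (rule recfn_onI)
    show "recfn n (\<lambda>xs. g (map (\<lambda>f. f xs) (map \<phi> Fs)))"
      by (rule recfn.comp[OF g(1)]) (use assms(2) \<phi>(1) in auto)
    fix xs :: "nat list" assume "length xs = n"
    then have "map (\<lambda>F. F xs) Fs = map (\<lambda>f. f xs) (map \<phi> Fs)" using \<phi>(2) by auto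
    then show "G (map (\<lambda>F. F xs) Fs) = g (map (\<lambda>f. f xs) (map \<phi> Fs))"
      using g(2) assms(2) by (metis length_map)
  qed
qed

lemma recfn_on_comp1: "recfn_on 1 G \<Longrightarrow> recfn_on n F \<Longrightarrow> recfn_on n (\<lambda>xs. G [F xs])"
  using recfn_on_comp[of 1 G "[F]" n] by simp

lemma recfn_on_comp2:
  "recfn_on 2 G \<Longrightarrow> recfn_on n F \<Longrightarrow> recfn_on n F' \<Longrightarrow> recfn_on n (\<lambda>xs. G [F xs, F' xs])"
  using recfn_on_comp[of 2 G "[F, F']" n] by auto

lemma recfn_on_rec:
  assumes "recfn_on n A" "recfn_on (Suc (Suc n)) H" "recfn_on n G"
  shows "recfn_on n (\<lambda>xs. rec_nat (A xs) (\<lambda>y r. H (y # r # xs)) (G xs))"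
proof -
  obtain a where a: "recfn n a" "\<And>xs. length xs = n \<Longrightarrow> A xs = a xs"
    using assms(1) unfolding recfn_on_def by blast
  obtain h where h: "recfn (Suc (Suc n)) h" "\<And>xs. length xs = Suc (Suc n) \<Longrightarrow> H xs = h xs"
    using assms(2) unfolding recfn_on_def by blast
  have "recfn_on (Suc n) (\<lambda>xs. rec_nat (a (tl xs)) (\<lambda>y r. h (y # r # tl xs)) (hd xs))"
    by (rule recfn_onI[OF recfn.prim[OF a(1) h(1)]]) simp
  \<comment> \<open>\<open>recfn.prim\<close> recurses on the head and takes the tail as parameters.
    Composing with \<open>G\<close> and all n projections puts \<open>G xs\<close> in the head while
    keeping the whole of \<open>xs\<close> as parameters.\<close>
  from recfn_on_comp[OF this, of "G # map (\<lambda>i xs. xs ! i) [0..<n]" n]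
  have "recfn_on n (\<lambda>xs. rec_nat (a (map (\<lambda>i. xs ! i) [0..<n]))
      (\<lambda>y r. h (y # r # map (\<lambda>i. xs ! i) [0..<n])) (G xs))"
    using assms(3) by (fastforce simp: o_def intro: recfn_on_proj)
  then show ?thesis
  proof (rule recfn_on_cong)
    fix xs :: "nat list" assume l: "length xs = n"
    then have m: "map (\<lambda>i. xs ! i) [0..<n] = xs" by (simp add: list_eq_iff_nth_eq)
    have "rec_nat (A xs) (\<lambda>y r. H (y # r # xs)) k = rec_nat (a xs) (\<lambda>y r. h (y # r # xs)) k" for k
      by (induction k) (use a h l in auto)
    then show "rec_nat (A xs) (\<lambda>y r. H (y # r # xs)) (G xs) = rec_nat (a (map (\<lambda>i. xs ! i) [0..<n]))
      (\<lambda>y r. h (y # r # map (\<lambda>i. xs ! i) [0..<n])) (G xs)" unfolding m by simp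
  qed
qed

lemma recfn_on_mu:
  assumes "recfn_on (Suc n) G" "\<And>xs. length xs = n \<Longrightarrow> \<exists>y. G (y # xs) = 0"
  shows "recfn_on n (\<lambda>xs. LEAST y. G (y # xs) = 0)"
proof -
  obtain g where g: "recfn (Suc n) g" "\<And>xs. length xs = Suc n \<Longrightarrow> G xs = g xs"
    using assms(1) unfolding recfn_on_def by blast
  show ?thesis
    by (rule recfn_onI[OF recfn.mu[OF g(1)]]) (use assms(2) g(2) in auto)
qed

lemma recfn_on_zero: "recfn_on n (\<lambda>_. 0)"
  by (rule recfn_onI[OF recfn.zero]) simp

lemma recfn_on_Suc: "recfn_on n F \<Longrightarrow> recfn_on n (\<lambda>xs. Suc (F xs))"
  using recfn_on_comp1[OF recfn_onI[OF recfn.succ], of "\<lambda>xs. Suc (hd xs)" n F] by simp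

lemma recfn_on_const: "recfn_on n (\<lambda>_. k)"
  by (induction k) (auto intro: recfn_on_zero recfn_on_Suc)

lemma recfn_on_plus:
  assumes "recfn_on n F" "recfn_on n G" shows "recfn_on n (\<lambda>xs. F xs + G xs)"
proof (rule recfn_on_cong)
  show "recfn_on n (\<lambda>xs. rec_nat (F xs) (\<lambda>y r. Suc ((y # r # xs) ! 1)) (G xs))"
    by (rule recfn_on_rec) (auto intro!: assms recfn_on_Suc recfn_on_proj)
  have "F xs + k = rec_nat (F xs) (\<lambda>y r. Suc ((y # r # xs) ! 1)) k" for xs k
    by (induction k) auto
  then show "F xs + G xs = rec_nat (F xs) (\<lambda>y r. Suc ((y # r # xs) ! 1)) (G xs)" for xs .
qed

lemma recfn_on_pred:
  assumes "recfn_on n F" shows "recfn_on n (\<lambda>xs. F xs - 1)"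
proof (rule recfn_on_cong)
  show "recfn_on n (\<lambda>xs. rec_nat 0 (\<lambda>y r. (y # r # xs) ! 0) (F xs))"
    by (rule recfn_on_rec) (auto intro!: assms recfn_on_proj recfn_on_zero)
  show "F xs - 1 = rec_nat 0 (\<lambda>y r. (y # r # xs) ! 0) (F xs)" for xs
    by (cases "F xs") auto
qed

lemma recfn_on_minus:
  assumes "recfn_on n F" "recfn_on n G" shows "recfn_on n (\<lambda>xs. F xs - G xs)"
proof (rule recfn_on_cong)
  show "recfn_on n (\<lambda>xs. rec_nat (F xs) (\<lambda>y r. (y # r # xs) ! 1 - 1) (G xs))"
    by (rule recfn_on_rec) (auto intro!: assms recfn_on_pred[unfolded One_nat_def] recfn_on_proj)
  have "F xs - k = rec_nat (F xs) (\<lambda>y r. (y # r # xs) ! 1 - 1) k" for xs k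
    by (induction k) auto
  then show "F xs - G xs = rec_nat (F xs) (\<lambda>y r. (y # r # xs) ! 1 - 1) (G xs)" for xs .
qed

lemma recfn_on_times:
  assumes "recfn_on n F" "recfn_on n G" shows "recfn_on n (\<lambda>xs. F xs * G xs)"
proof -
  have "recfn_on 2 (\<lambda>xs. xs ! 0 * xs ! 1)"
  proof (rule recfn_on_cong)
    show "recfn_on 2 (\<lambda>xs. rec_nat 0 (\<lambda>y r. (y # r # xs) ! 1 + (y # r # xs) ! 2) (xs ! 1))"
      by (rule recfn_on_rec) (auto intro!: recfn_on_plus recfn_on_proj recfn_on_zero)
    have "xs ! 0 * k = rec_nat 0 (\<lambda>y r. (y # r # xs) ! 1 + (y # r # xs) ! 2) k" for k and xs :: "nat list"
      by (induction k) auto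
    then show "xs ! 0 * xs ! 1 = rec_nat 0 (\<lambda>y r. (y # r # xs) ! 1 + (y # r # xs) ! 2) (xs ! 1)"
      for xs :: "nat list" .
  qed
  from recfn_on_comp2[OF this assms] show ?thesis by simp
qed

lemma recfn_on_triangle:
  assumes "recfn_on n F" shows "recfn_on n (\<lambda>xs. triangle (F xs))"
proof (rule recfn_on_cong)
  show "recfn_on n (\<lambda>xs. rec_nat 0 (\<lambda>y r. (y # r # xs) ! 1 + Suc ((y # r # xs) ! 0)) (F xs))"
    by (rule recfn_on_rec) (auto intro!: assms recfn_on_plus recfn_on_Suc recfn_on_proj recfn_on_zero
      simp del: add_Suc_right)
  have "triangle k = rec_nat 0 (\<lambda>y r. (y # r # xs) ! 1 + Suc ((y # r # xs) ! 0)) k" for k and xs :: "nat list"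
    by (induction k) auto
  then show "triangle (F xs) = rec_nat 0 (\<lambda>y r. (y # r # xs) ! 1 + Suc ((y # r # xs) ! 0)) (F xs)" for xs .
qed

section \<open>The inverse of Cantor pairing\<close>

definition pfst :: "nat \<Rightarrow> nat" where "pfst x = fst (prod_decode x)"
definition psnd :: "nat \<Rightarrow> nat" where "psnd x = snd (prod_decode x)"

lemma pfst_prod_encode [simp]: "pfst (prod_encode (a, b)) = a"
  and psnd_prod_encode [simp]: "psnd (prod_encode (a, b)) = b"
  by (simp_all add: pfst_def psnd_def)

lemma prod_encode_pfst_psnd [simp]: "prod_encode (pfst x, psnd x) = x"
  by (simp add: pfst_def psnd_def)

lemma prod_decode_eq: "prod_decode x = (pfst x, psnd x)"
  by (simp add: pfst_def psnd_def)

lemma recfn_on_prod_encode: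
  assumes "recfn_on n F" "recfn_on n G" shows "recfn_on n (\<lambda>xs. prod_encode (F xs, G xs))"
  unfolding prod_encode_def by (auto intro!: assms recfn_on_triangle recfn_on_plus)

lemma triangle_mono: "a \<le> b \<Longrightarrow> triangle a \<le> triangle b"
  unfolding triangle_def by (intro div_le_mono mult_le_mono) auto

text \<open>The code of (a, b) is \<open>triangle (a + b) + a\<close>, which lies below
  \<open>triangle (a + b + 1)\<close>. So the diagonal a + b is found by a search that always stops,
  and both components follow by subtraction.\<close>

lemma pfst_plus_psnd: "pfst x + psnd x = (LEAST s. x < triangle (Suc s))"
proof -
  obtain a b where x: "x = prod_encode (a, b)" by (metis prod_encode_pfst_psnd)
  then have xx: "x = triangle (a + b) + a" by (simp add: prod_encode_def)
  have "(LEAST s. x < triangle (Suc s)) = a + b"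
  proof (rule Least_equality)
    show "x < triangle (Suc (a + b))" using xx by simp
    fix s assume s: "x < triangle (Suc s)"
    show "a + b \<le> s"
    proof (rule ccontr)
      assume "\<not> a + b \<le> s"
      then have "triangle (Suc s) \<le> triangle (a + b)" by (intro triangle_mono) simp
      then show False using s xx by simp
    qed
  qed
  then show ?thesis using x by simp
qed

lemma recfn_on_pfst_plus_psnd:
  assumes "recfn_on n F" shows "recfn_on n (\<lambda>xs. pfst (F xs) + psnd (F xs))"
proof -
  \<comment> \<open>\<open>x < triangle (Suc y)\<close> is written as the vanishing of a truncated
    difference, the form that minimization requires.\<close>
  have "recfn_on 1 (\<lambda>xs. LEAST y. Suc ((y # xs) ! 1) - triangle (Suc ((y # xs) ! 0)) = 0)"
  proof (rule recfn_on_mu)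
    show "recfn_on (Suc 1) (\<lambda>xs. Suc (xs ! 1) - triangle (Suc (xs ! 0)))"
      by (intro recfn_on_minus recfn_on_Suc recfn_on_triangle recfn_on_proj) auto
    fix xs :: "nat list" assume "length xs = 1"
    show "\<exists>y. Suc ((y # xs) ! 1) - triangle (Suc ((y # xs) ! 0)) = 0"
      by (rule exI[of _ "Suc (xs ! 0)"]) simp
  qed
  from recfn_on_comp1[OF this assms] show ?thesis
    unfolding pfst_plus_psnd by (rule recfn_on_cong) (simp add: Suc_le_eq del: triangle_Suc)
qed

lemma pfst_eq: "pfst x = x - triangle (pfst x + psnd x)"
proof -
  have "triangle (pfst x + psnd x) + pfst x = x"
    using prod_encode_pfst_psnd[of x] unfolding prod_encode_def prod.case .
  then show ?thesis by linarith
qed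

lemma recfn_on_pfst:
  assumes "recfn_on n F" shows "recfn_on n (\<lambda>xs. pfst (F xs))"
  by (rule recfn_on_cong[OF recfn_on_minus[OF assms recfn_on_triangle[OF recfn_on_pfst_plus_psnd[OF assms]]]])
    (rule pfst_eq)

lemma recfn_on_psnd:
  assumes "recfn_on n F" shows "recfn_on n (\<lambda>xs. psnd (F xs))"
  by (rule recfn_on_cong[OF recfn_on_minus[OF recfn_on_pfst_plus_psnd[OF assms] recfn_on_pfst[OF assms]]])
    simp

section \<open>Unary computable functions with packed arguments\<close>

lemma computable_iff: "computable F \<longleftrightarrow> recfn_on 1 (\<lambda>xs. F (xs ! 0))"
proof
  assume "computable F"
  then obtain f where "recfn 1 f" "\<forall>x. F x = f [x]" by (auto simp: computable_def)
  then show "recfn_on 1 (\<lambda>xs. F (xs ! 0))"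
    by (intro recfn_onI[where f = f]) (auto simp: length_Suc_conv)
next
  assume "recfn_on 1 (\<lambda>xs. F (xs ! 0))"
  then obtain f where f: "recfn 1 f" "\<And>xs. length xs = 1 \<Longrightarrow> F (xs ! 0) = f xs"
    by (auto simp: recfn_on_def)
  then show "computable F" unfolding computable_def using f(2)[of "[_]"] by auto
qed

lemma computable_id: "computable (\<lambda>x. x)"
  and computable_const: "computable (\<lambda>x. k)"
  and computable_Suc: "computable F \<Longrightarrow> computable (\<lambda>x. Suc (F x))"
  and computable_pfst: "computable F \<Longrightarrow> computable (\<lambda>x. pfst (F x))"
  and computable_psnd: "computable F \<Longrightarrow> computable (\<lambda>x. psnd (F x))"
  and computable_plus: "computable F \<Longrightarrow> computable G \<Longrightarrow> computable (\<lambda>x. F x + G x)"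
  and computable_times: "computable F \<Longrightarrow> computable G \<Longrightarrow> computable (\<lambda>x. F x * G x)"
  and computable_minus: "computable F \<Longrightarrow> computable G \<Longrightarrow> computable (\<lambda>x. F x - G x)"
  and computable_prod_encode:
    "computable F \<Longrightarrow> computable G \<Longrightarrow> computable (\<lambda>x. prod_encode (F x, G x))"
  unfolding computable_iff
  by (auto intro: recfn_on_proj recfn_on_const recfn_on_Suc recfn_on_pfst recfn_on_psnd
      recfn_on_plus recfn_on_minus recfn_on_times recfn_on_prod_encode)

lemma computable_comp: "computable G \<Longrightarrow> computable F \<Longrightarrow> computable (\<lambda>x. G (F x))"
  unfolding computable_iff using recfn_on_comp1[of "\<lambda>xs. G (xs ! 0)" 1 "\<lambda>xs. F (xs ! 0)"] by simp

text \<open>\<open>computable\<close> concerns unary functions, so several arguments are packed into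
  one number; the composition lemmas below hide the packing again.\<close>

definition computable2 :: "(nat \<Rightarrow> nat \<Rightarrow> nat) \<Rightarrow> bool" where
  "computable2 H \<longleftrightarrow> computable (\<lambda>p. H (pfst p) (psnd p))"

definition computable3 :: "(nat \<Rightarrow> nat \<Rightarrow> nat \<Rightarrow> nat) \<Rightarrow> bool" where
  "computable3 H \<longleftrightarrow> computable (\<lambda>p. H (pfst p) (pfst (psnd p)) (psnd (psnd p)))"

lemma computable2I: "computable (\<lambda>p. H (pfst p) (psnd p)) \<Longrightarrow> computable2 H"
  and computable3I: "computable (\<lambda>p. K (pfst p) (pfst (psnd p)) (psnd (psnd p))) \<Longrightarrow> computable3 K"
  by (simp_all add: computable2_def computable3_def)

lemma computable2_comp:
  assumes "computable2 H" "computable F" "computable G" shows "computable (\<lambda>x. H (F x) (G x))"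
  using computable_comp[OF assms(1)[unfolded computable2_def] computable_prod_encode[OF assms(2,3)]] by simp

lemma computable3_comp:
  assumes "computable3 H" "computable F" "computable G" "computable K"
  shows "computable (\<lambda>x. H (F x) (G x) (K x))"
  using computable_comp[OF assms(1)[unfolded computable3_def]
      computable_prod_encode[OF assms(2) computable_prod_encode[OF assms(3,4)]]] by simp

lemma computable_rec:
  assumes "computable A" "computable3 H" "computable G"
  shows "computable (\<lambda>x. rec_nat (A x) (\<lambda>y r. H x y r) (G x))"
proof -
  \<comment> \<open>The recursor supplies y, r, x at positions 0, 1, 2, and
    \<open>computable3\<close> expects the packed triple (x, y, r).\<close>
  have "recfn_on 1 (\<lambda>xs. rec_nat (A (xs ! 0))
     (\<lambda>y r. (\<lambda>p. H (pfst p) (pfst (psnd p)) (psnd (psnd p)))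
        (prod_encode ((y # r # xs) ! 2, prod_encode ((y # r # xs) ! 0, (y # r # xs) ! 1)))) (G (xs ! 0)))"
  proof (rule recfn_on_rec)
    have "recfn_on (Suc (Suc 1)) (\<lambda>a. prod_encode (a ! 2, prod_encode (a ! 0, a ! 1)))"
      by (intro recfn_on_prod_encode recfn_on_proj) auto
    from recfn_on_comp1[OF assms(2)[unfolded computable3_def computable_iff] this]
    show "recfn_on (Suc (Suc 1)) (\<lambda>a. (\<lambda>p. H (pfst p) (pfst (psnd p)) (psnd (psnd p)))
        (prod_encode (a ! 2, prod_encode (a ! 0, a ! 1))))" by simp
  qed (use assms in \<open>auto simp: computable_iff\<close>)
  then show ?thesis unfolding computable_iff by simp
qed

lemma computable_mu:
  assumes "computable2 G" "\<And>x. \<exists>y. G x y = 0"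
  shows "computable (\<lambda>x. LEAST y. G x y = 0)"
proof -
  have "recfn_on 1 (\<lambda>xs. LEAST y. (\<lambda>p. G (pfst p) (psnd p))
        (prod_encode ((y # xs) ! 1, (y # xs) ! 0)) = 0)"
  proof (rule recfn_on_mu)
    have "recfn_on (Suc 1) (\<lambda>a. prod_encode (a ! 1, a ! 0))"
      by (intro recfn_on_prod_encode recfn_on_proj) auto
    from recfn_on_comp1[OF assms(1)[unfolded computable2_def computable_iff] this]
    show "recfn_on (Suc 1) (\<lambda>a. (\<lambda>p. G (pfst p) (psnd p)) (prod_encode (a ! 1, a ! 0)))" by simp
  qed (use assms in auto)
  then show ?thesis unfolding computable_iff by simp
qed

section \<open>Decidable predicates and bounded quantifiers\<close>

definition decidable :: "(nat \<Rightarrow> bool) \<Rightarrow> bool" where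
  "decidable P \<longleftrightarrow> computable (\<lambda>x. of_bool (P x))"

definition decidable2 :: "(nat \<Rightarrow> nat \<Rightarrow> bool) \<Rightarrow> bool" where
  "decidable2 P \<longleftrightarrow> decidable (\<lambda>p. P (pfst p) (psnd p))"

definition decidable3 :: "(nat \<Rightarrow> nat \<Rightarrow> nat \<Rightarrow> bool) \<Rightarrow> bool" where
  "decidable3 P \<longleftrightarrow> decidable (\<lambda>p. P (pfst p) (pfst (psnd p)) (psnd (psnd p)))"

lemma decidable2I: "decidable (\<lambda>p. P (pfst p) (psnd p)) \<Longrightarrow> decidable2 P"
  and decidable3I: "decidable (\<lambda>p. Q (pfst p) (pfst (psnd p)) (psnd (psnd p))) \<Longrightarrow> decidable3 Q"
  by (simp_all add: decidable2_def decidable3_def)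

lemma decidable_comp: "decidable P \<Longrightarrow> computable F \<Longrightarrow> decidable (\<lambda>x. P (F x))"
  unfolding decidable_def by (rule computable_comp)

lemma decidable2_comp: "decidable2 P \<Longrightarrow> computable F \<Longrightarrow> computable G \<Longrightarrow> decidable (\<lambda>x. P (F x) (G x))"
  using computable2_comp[of "\<lambda>x y. of_bool (P x y)" F G]
  by (simp add: decidable_def decidable2_def computable2_def)

lemma decidable3_comp:
  "decidable3 P \<Longrightarrow> computable F \<Longrightarrow> computable G \<Longrightarrow> computable K \<Longrightarrow> decidable (\<lambda>x. P (F x) (G x) (K x))"
  using computable3_comp[of "\<lambda>x y z. of_bool (P x y z)" F G K]
  by (simp add: decidable_def decidable3_def computable3_def)

lemma of_bool_not_iff_nat: "(of_bool (\<not> P) :: nat) = 1 - of_bool P"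
  by simp

lemma decidable_not: "decidable P \<Longrightarrow> decidable (\<lambda>x. \<not> P x)"
  unfolding decidable_def of_bool_not_iff_nat
  by (intro computable_minus computable_const)

lemma decidable_conj: "decidable P \<Longrightarrow> decidable Q \<Longrightarrow> decidable (\<lambda>x. P x \<and> Q x)"
  unfolding decidable_def of_bool_conj by (rule computable_times)

lemma decidable_disj: "decidable P \<Longrightarrow> decidable Q \<Longrightarrow> decidable (\<lambda>x. P x \<or> Q x)"
  using decidable_not[OF decidable_conj[OF decidable_not[of P] decidable_not[of Q]]] by simp

lemma decidable_imp: "decidable P \<Longrightarrow> decidable Q \<Longrightarrow> decidable (\<lambda>x. P x \<longrightarrow> Q x)"
  unfolding imp_conv_disj by (intro decidable_disj decidable_not)

lemma decidable_eq_0: "computable F \<Longrightarrow> decidable (\<lambda>x. F x = 0)"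
proof -
  assume "computable F"
  then have "computable (\<lambda>x. 1 - F x)" by (intro computable_minus computable_const)
  moreover have "1 - F x = of_bool (F x = 0)" for x by auto
  ultimately show ?thesis unfolding decidable_def by simp
qed

lemma decidable_le: "computable F \<Longrightarrow> computable G \<Longrightarrow> decidable (\<lambda>x. F x \<le> G x)"
  using decidable_eq_0[OF computable_minus[of F G]] by simp

lemma decidable_less: "computable F \<Longrightarrow> computable G \<Longrightarrow> decidable (\<lambda>x. F x < G x)"
  using decidable_not[OF decidable_le[of G F]] by (simp add: not_le)

lemma decidable_eq: "computable F \<Longrightarrow> computable G \<Longrightarrow> decidable (\<lambda>x. F x = G x)"
  unfolding eq_iff by (intro decidable_conj decidable_le)

lemma computable_if:
  assumes "decidable P" "computable F" "computable G"
  shows "computable (\<lambda>x. if P x then F x else G x)"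
proof -
  have "computable (\<lambda>x. of_bool (P x) * F x + (1 - of_bool (P x)) * G x)"
    using assms unfolding decidable_def
    by (intro computable_plus computable_times computable_minus computable_const)
  moreover have "of_bool (P x) * F x + (1 - of_bool (P x)) * G x = (if P x then F x else G x)" for x
    by simp
  ultimately show ?thesis by simp
qed

lemma decidable_ex_less:
  assumes "computable G" "decidable2 P" shows "decidable (\<lambda>x. \<exists>y<G x. P x y)"
proof -
  have "computable3 (\<lambda>x y r. if P x y then 1 else r)"
    by (intro computable3I computable_if decidable2_comp[OF assms(2)] computable_pfst computable_psnd
        computable_id computable_const)
  from computable_rec[OF computable_const[of 0] this assms(1)]
  have "computable (\<lambda>x. rec_nat 0 (\<lambda>y r. if P x y then 1 else r) (G x))" .
  moreover have "rec_nat 0 (\<lambda>y r. if P x y then 1 else r) k = (of_bool (\<exists>y<k. P x y) :: nat)" for x k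
    by (induction k) (auto simp: less_Suc_eq)
  ultimately show ?thesis unfolding decidable_def by simp
qed

lemma decidable_all_less:
  assumes "computable G" "decidable2 P" shows "decidable (\<lambda>x. \<forall>y<G x. P x y)"
proof -
  have "decidable2 (\<lambda>x y. \<not> P x y)" using assms(2) unfolding decidable2_def by (rule decidable_not)
  from decidable_not[OF decidable_ex_less[OF assms(1) this]] show ?thesis by simp
qed

lemmas computable_intros =
  computable_id computable_const computable_Suc computable_pfst computable_psnd computable_plus
  computable_times computable_minus computable_prod_encode computable_if
  decidable_not decidable_conj decidable_disj decidable_imp decidable_le decidable_less decidable_eq
  decidable_ex_less decidable_all_less computable2I computable3I decidable2I decidable3I

section \<open>Coded lists\<close>

lemma pfst_0 [simp]: "pfst 0 = 0" and psnd_0 [simp]: "psnd 0 = 0"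
  by (simp_all add: pfst_def psnd_def prod_decode_def prod_decode_aux.simps)

text \<open>Entries beyond the end of a coded list read as 0.\<close>

definition code_nth :: "nat \<Rightarrow> nat \<Rightarrow> nat" where
  "code_nth s i = (if i < length (list_decode s) then list_decode s ! i else 0)"

definition code_length :: "nat \<Rightarrow> nat" where
  "code_length s = length (list_decode s)"

text \<open>A nonempty list is coded by the successor of the pair (head, code of tail), so
  \<open>psnd (r - 1)\<close> is the tail. For the empty list, with code 0, it gives 0
  again.\<close>

lemma list_decode_drop:
  "list_decode (rec_nat s (\<lambda>y r. psnd (r - 1)) i) = drop i (list_decode s)"
proof (induction i)
  case (Suc i)
  have "list_decode (psnd (r - 1)) = tl (list_decode r)" for r
    by (cases r) (auto simp: prod_decode_eq)
  then show ?case by (simp add: Suc drop_Suc tl_drop del: One_nat_def)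
qed simp

lemma computable_drop:
  "computable F \<Longrightarrow> computable G \<Longrightarrow> computable (\<lambda>x. rec_nat (F x) (\<lambda>y r. psnd (r - 1)) (G x))"
  by (rule computable_rec) (intro computable_intros | assumption)+

lemma computable_code_nth:
  assumes "computable F" "computable G" shows "computable (\<lambda>x. code_nth (F x) (G x))"
proof -
  have "pfst (r - 1) = (case list_decode r of [] \<Rightarrow> 0 | a # _ \<Rightarrow> a)" for r
    by (cases r) (auto simp: prod_decode_eq)
  then have "code_nth s i = pfst (rec_nat s (\<lambda>y r. psnd (r - 1)) i - 1)" for s i
    by (cases "i < length (list_decode s)")
      (auto simp: list_decode_drop code_nth_def Cons_nth_drop_Suc[symmetric] simp del: One_nat_def)
  moreover have "computable (\<lambda>x. pfst (rec_nat (F x) (\<lambda>y r. psnd (r - 1)) (G x) - 1))"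
    by (intro computable_intros computable_drop assms)
  ultimately show ?thesis by simp
qed

text \<open>Only the empty list has code 0, so the length is the least number of tails after which
  the code is 0.\<close>

lemma computable_code_length:
  assumes "computable F" shows "computable (\<lambda>x. code_length (F x))"
proof -
  have *: "rec_nat s (\<lambda>y r. psnd (r - 1)) i = 0 \<longleftrightarrow> length (list_decode s) \<le> i" for s i
    using list_decode_drop[of s i]
    by (metis drop_eq_Nil list_decode.simps(1) list_decode_inverse list_encode.simps(1))
  have "code_length s = (LEAST i. rec_nat s (\<lambda>y r. psnd (r - 1)) i = 0)" for s
    unfolding * code_length_def by (intro Least_equality[symmetric]) auto
  moreover have "computable (\<lambda>x. LEAST i. rec_nat x (\<lambda>y r. psnd (r - 1)) i = 0)"
  proof (rule computable_mu)
    show "computable2 (\<lambda>x i. rec_nat x (\<lambda>y r. psnd (r - 1)) i)"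
      by (intro computable2I computable_drop computable_intros)
  qed (use * in blast)
  ultimately show ?thesis using computable_comp[OF _ assms] by simp
qed

lemma computable_tabulate:
  assumes "computable2 H" "computable G"
  shows "computable (\<lambda>x. list_encode (map (H x) [0..<G x]))"
proof -
  \<comment> \<open>The list is built from the back, one head at a time: step \<open>y\<close>
    prepends the entry with index \<open>G x - Suc y\<close>.\<close>
  have "computable (\<lambda>x. rec_nat 0 (\<lambda>y r. Suc (prod_encode (H x (G x - Suc y), r))) (G x))"
    by (rule computable_rec) (intro computable_intros computable2_comp[OF assms(1)]
        computable_comp[OF assms(2)] assms(2))+
  moreover have "rec_nat 0 (\<lambda>y r. Suc (prod_encode (H x (n - Suc y), r))) k =
    list_encode (map (H x) [n - k..<n])" if "k \<le> n" for x n k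
    using that
  proof (induction k)
    case (Suc k)
    then have "[n - Suc k..<n] = (n - Suc k) # [n - k..<n]"
      by (metis Suc_diff_Suc Suc_le_lessD diff_less upt_conv_Cons zero_less_Suc less_le_trans Suc_le_eq)
    then show ?case using Suc by simp
  qed simp
  ultimately show ?thesis by simp
qed

section \<open>Arithmetical sets and coded rational arithmetic\<close>

lemma code_length_init_code [simp]: "code_length (init_code f b) = b"
  by (simp add: code_length_def init_code_def)

lemma code_nth_init_code: "i < b \<Longrightarrow> code_nth (init_code f b) i = f i"
  by (simp add: code_nth_def init_code_def)

lemma init_code_prefix:
  "b' \<le> b \<Longrightarrow> list_encode (map (code_nth (init_code f b)) [0..<b']) = init_code f b'"
  unfolding init_code_def[of f b'] by (intro arg_cong[of _ _ list_encode] map_cong) (auto simp: code_nth_init_code)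

text \<open>\<open>Pi02\<close> has a single witness b, the length of the part of \<open>f\<close>
  that is read. Taking b as the code of (w, t) provides both witnesses, and t \<le> b lets
  \<open>init_code f t\<close> be recovered from \<open>init_code f b\<close>.\<close>

lemma Pi02I:
  assumes "decidable3 Q"
  shows "Pi02 {f. \<forall>a. \<exists>w t. Q a w (init_code f t)}"
proof -
  define R where "R p = (of_bool (Q (pfst p) (pfst (code_length (psnd p)))
     (list_encode (map (code_nth (psnd p)) [0..<psnd (code_length (psnd p))]))) :: nat)" for p
  have "computable R"
    unfolding R_def decidable_def[symmetric]
    by (intro decidable3_comp[OF assms] computable_tabulate computable_intros computable_code_length
        computable_code_nth)
  moreover have "(\<forall>a. \<exists>w t. Q a w (init_code f t)) \<longleftrightarrow>
     (\<forall>a. \<exists>b. R (prod_encode (a, init_code f b)) \<noteq> 0)" for f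
  proof -
    have "R (prod_encode (a, init_code f b)) \<noteq> 0 \<longleftrightarrow> Q a (pfst b) (init_code f (psnd b))" for a b
    proof -
      have "psnd b \<le> b" by (metis le_prod_encode_2 prod_encode_pfst_psnd)
      then show ?thesis by (simp add: R_def init_code_prefix)
    qed
    then show ?thesis by simp (metis pfst_prod_encode psnd_prod_encode)
  qed
  ultimately show ?thesis unfolding Pi02_def by auto
qed

text \<open>The outer argument is read as a pair whose first component selects one of the two
  conditions.\<close>

lemma Pi02_Int:
  assumes "Pi02 S" "Pi02 T" shows "Pi02 (S \<inter> T)"
proof -
  obtain R where R: "computable R" "\<And>f. f \<in> S \<longleftrightarrow> (\<forall>a. \<exists>b. R (prod_encode (a, init_code f b)) \<noteq> 0)"
    using assms(1) unfolding Pi02_def by blast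
  obtain R' where R': "computable R'" "\<And>f. f \<in> T \<longleftrightarrow> (\<forall>a. \<exists>b. R' (prod_encode (a, init_code f b)) \<noteq> 0)"
    using assms(2) unfolding Pi02_def by blast
  define K where "K p = (if pfst (pfst p) = 0 then R (prod_encode (psnd (pfst p), psnd p))
     else R' (prod_encode (psnd (pfst p), psnd p)))" for p
  have "computable K" unfolding K_def
    by (intro computable_intros computable_comp[OF R(1)] computable_comp[OF R'(1)])
  moreover have "f \<in> S \<inter> T \<longleftrightarrow> (\<forall>a. \<exists>b. K (prod_encode (a, init_code f b)) \<noteq> 0)" for f
  proof
    assume "f \<in> S \<inter> T"
    then have "\<exists>b. R (prod_encode (psnd a, init_code f b)) \<noteq> 0" "\<exists>b. R' (prod_encode (psnd a, init_code f b)) \<noteq> 0" for a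
      using R(2) R'(2) by blast+
    then have "\<exists>b. K (prod_encode (a, init_code f b)) \<noteq> 0" for a
      unfolding K_def pfst_prod_encode psnd_prod_encode by (cases "pfst a = 0") simp_all
    then show "\<forall>a. \<exists>b. K (prod_encode (a, init_code f b)) \<noteq> 0" by blast
  next
    assume *: "\<forall>a. \<exists>b. K (prod_encode (a, init_code f b)) \<noteq> 0"
    have "\<exists>b. R (prod_encode (a, init_code f b)) \<noteq> 0" for a
      using *[rule_format, of "prod_encode (0, a)"] by (simp add: K_def)
    moreover have "\<exists>b. R' (prod_encode (a, init_code f b)) \<noteq> 0" for a
      using *[rule_format, of "prod_encode (1, a)"] by (simp add: K_def)
    ultimately show "f \<in> S \<inter> T" using R(2) R'(2) by simp
  qed
  ultimately show ?thesis unfolding Pi02_def by blast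
qed

text \<open>The reduction releases the value \<open>f\<^sub>0 j\<close> only once the \<open>\<Pi>\<^sub>2\<close> condition has been verified for all
  \<open>a \<le> j\<close>; if the condition fails, only finitely many values are released.\<close>

lemma Pi02_hardI:
  assumes "computable f0" "f0 \<in> S"
    and inf: "\<And>f. f \<in> S \<Longrightarrow> infinite (range f)"
    and cong: "\<And>f g. f \<in> S \<Longrightarrow> range g = range f \<Longrightarrow> g \<in> S"
    and "Pi02 P"
  shows "\<exists>F. computable_operator F \<and> (\<forall>f. f \<in> P \<longleftrightarrow> F f \<in> S)"
proof -
  obtain R where R: "computable R" "\<And>f. f \<in> P \<longleftrightarrow> (\<forall>a. \<exists>b. R (prod_encode (a, init_code f b)) \<noteq> 0)"
    using assms(5) unfolding Pi02_def by blast
  define ok where "ok n s \<longleftrightarrow> (\<forall>a<Suc (pfst n). \<exists>b<Suc (psnd n).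
     \<not> R (prod_encode (a, list_encode (map (code_nth s) [0..<b]))) = 0)" for n s
  define e where "e p = (if code_length (psnd p) < psnd (pfst p) then 0
     else Suc (if ok (pfst p) (psnd p) then f0 (pfst (pfst p)) else f0 0))" for p
  \<comment> \<open>The argument codes (j, b): j is the value waiting to be released, b bounds the
    search and the part of \<open>f\<close> that is read. A failed check outputs
    \<open>f0 0\<close>, which keeps the operator total without leaving the range of
    \<open>f0\<close>.\<close>
  define F where "F f n = (if \<forall>a\<le>pfst n. \<exists>b\<le>psnd n. R (prod_encode (a, init_code f b)) \<noteq> 0
     then f0 (pfst n) else f0 0)" for f n
  have ok: "decidable2 ok" unfolding ok_def
    by (intro computable_intros computable_tabulate computable_code_nth computable_comp[OF R(1)])
  have e: "computable e" unfolding e_def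
    by (intro computable_intros computable_code_length decidable2_comp[OF ok] computable_comp[OF assms(1)])
  have Fe: "(\<exists>k. e (prod_encode (n, init_code f k)) \<noteq> 0) \<and>
      F f n = e (prod_encode (n, init_code f (LEAST k. e (prod_encode (n, init_code f k)) \<noteq> 0))) - 1" for f n
  proof -
    have "(LEAST k. e (prod_encode (n, init_code f k)) \<noteq> 0) = psnd n"
      by (rule Least_equality) (auto simp: e_def split: if_splits)
    moreover have "ok n (init_code f (psnd n)) \<longleftrightarrow>
       (\<forall>a\<le>pfst n. \<exists>b\<le>psnd n. R (prod_encode (a, init_code f b)) \<noteq> 0)"
      unfolding ok_def less_Suc_eq_le by (metis init_code_prefix)
    ultimately show ?thesis by (auto simp: e_def F_def intro!: exI[of _ "psnd n"])
  qed
  have "f \<in> P \<longleftrightarrow> F f \<in> S" for f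
  proof
    assume "f \<in> P"
    then obtain \<beta> where \<beta>: "\<And>a. R (prod_encode (a, init_code f (\<beta> a))) \<noteq> 0" unfolding R(2) by metis
    have "f0 j \<in> range (F f)" for j
    proof -
      have "\<forall>a\<le>j. \<exists>b\<le>Max (\<beta> ` {..j}). R (prod_encode (a, init_code f b)) \<noteq> 0"
        using \<beta> by (meson Max_ge finite_atMost finite_imageI image_eqI atMost_iff)
      then have "F f (prod_encode (j, Max (\<beta> ` {..j}))) = f0 j"
        unfolding F_def pfst_prod_encode psnd_prod_encode by simp
      then show ?thesis by (metis rangeI)
    qed
    then have "range (F f) = range f0" by (auto simp: F_def)
    then show "F f \<in> S" using cong[OF assms(2)] by blast
  next
    assume "F f \<in> S"
    show "f \<in> P"
    proof (rule ccontr)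
      assume "f \<notin> P"
      then obtain a where a: "\<And>b. R (prod_encode (a, init_code f b)) = 0" unfolding R(2) by blast
      \<comment> \<open>Releasing \<open>f0 j\<close> with j \<ge> a would require a successful
        check for a, and no b provides one.\<close>
      have "range (F f) \<subseteq> f0 ` {..a}"
      proof
        fix x assume "x \<in> range (F f)"
        then obtain n where "x = F f n" by blast
        then show "x \<in> f0 ` {..a}" using a
          by (cases "a \<le> pfst n") (auto simp: F_def)
      qed
      then show False using inf[OF \<open>F f \<in> S\<close>] finite_subset by blast
    qed
  qed
  moreover have "computable_operator F"
    unfolding computable_operator_def using e Fe by blast
  ultimately show ?thesis by blast
qed

section \<open>Exact arithmetic on coded rationals\<close>

lemma computable_half:
  assumes "computable F" shows "computable (\<lambda>x. F x div 2)"
proof -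
  have *: "x - (2 * y + 1) = 0 \<longleftrightarrow> x div 2 \<le> y" for x y :: nat by auto
  have "computable (\<lambda>x. LEAST y. x - (2 * y + 1) = 0)"
  proof (rule computable_mu)
    show "computable2 (\<lambda>x y. x - (2 * y + 1))" by (intro computable_intros)
  qed (use * in blast)
  moreover have "(LEAST y. x - (2 * y + 1) = 0) = x div 2" for x :: nat
    unfolding * by (rule Least_equality) auto
  ultimately have "computable (\<lambda>x. x div 2)" by simp
  from computable_comp[OF this assms] show ?thesis .
qed

lemma decidable_even: "computable F \<Longrightarrow> decidable (\<lambda>x. even (F x))"
proof -
  assume F: "computable F"
  have "decidable (\<lambda>x. 2 * (F x div 2) = F x)" by (intro computable_intros computable_half F)
  moreover have "2 * (n div 2) = n \<longleftrightarrow> even n" for n :: nat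
    by (metis dvd_mult_div_cancel dvd_triv_left)
  ultimately show ?thesis by simp
qed

text \<open>The integer code 2 k stands for k and 2 k + 1 for -(k + 1). Separate positive and
  negative parts reduce rational arithmetic to natural numbers.\<close>

definition rat_pos :: "nat \<Rightarrow> nat" where
  "rat_pos c = (if even (pfst c) then pfst c div 2 else 0)"
definition rat_neg :: "nat \<Rightarrow> nat" where
  "rat_neg c = (if even (pfst c) then 0 else Suc (pfst c div 2))"
definition rat_den :: "nat \<Rightarrow> nat" where
  "rat_den c = Suc (psnd c)"
text \<open>A negative integer -m has code 2 m - 1, and denominators are stored minus one. Fractions
  are not reduced: a rational has many codes.\<close>

definition rat_mk :: "nat \<Rightarrow> nat \<Rightarrow> nat \<Rightarrow> nat" where
  "rat_mk p n d = prod_encode (if n \<le> p then 2 * (p - n) else 2 * (n - p) - 1, d - 1)"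

lemma rat_dec_eq: "rat_dec c = (real (rat_pos c) - real (rat_neg c)) / real (rat_den c)"
  by (simp add: rat_dec_def prod_decode_eq rat_pos_def rat_neg_def rat_den_def int_decode_def sum_decode_def)

lemma rat_den_pos: "rat_den c > 0" by (simp add: rat_den_def)

lemma rat_dec_rat_mk:
  assumes "d > 0" shows "rat_dec (rat_mk p n d) = (real p - real n) / real d"
proof (cases "n \<le> p")
  case False
  define k where "k = n - p - 1"
  have n: "n = p + Suc k" using False by (simp add: k_def)
  have "2 * (n - p) - 1 = Suc (2 * k)" using n by simp
  then show ?thesis using assms n
    by (simp add: rat_dec_eq rat_mk_def rat_pos_def rat_neg_def rat_den_def)
qed (use assms in \<open>simp add: rat_dec_eq rat_mk_def rat_pos_def rat_neg_def rat_den_def of_nat_diff\<close>)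

definition rat_add :: "nat \<Rightarrow> nat \<Rightarrow> nat" where
  "rat_add a b = rat_mk (rat_pos a * rat_den b + rat_pos b * rat_den a)
     (rat_neg a * rat_den b + rat_neg b * rat_den a) (rat_den a * rat_den b)"
definition rat_mul :: "nat \<Rightarrow> nat \<Rightarrow> nat" where
  "rat_mul a b = rat_mk (rat_pos a * rat_pos b + rat_neg a * rat_neg b)
     (rat_pos a * rat_neg b + rat_neg a * rat_pos b) (rat_den a * rat_den b)"
definition rat_uminus :: "nat \<Rightarrow> nat" where
  "rat_uminus a = rat_mk (rat_neg a) (rat_pos a) (rat_den a)"

lemma rat_dec_rat_add [simp]: "rat_dec (rat_add a b) = rat_dec a + rat_dec b"
  using rat_den_pos[of a] rat_den_pos[of b] unfolding rat_add_def
  by (subst rat_dec_rat_mk) (auto simp: rat_dec_eq field_simps)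

lemma rat_dec_rat_mul [simp]: "rat_dec (rat_mul a b) = rat_dec a * rat_dec b"
  using rat_den_pos[of a] rat_den_pos[of b] unfolding rat_mul_def
  by (subst rat_dec_rat_mk) (auto simp: rat_dec_eq field_simps)

lemma rat_dec_rat_uminus [simp]: "rat_dec (rat_uminus a) = - rat_dec a"
  using rat_den_pos[of a] unfolding rat_uminus_def
  by (subst rat_dec_rat_mk) (auto simp: rat_dec_eq field_simps)

lemma computable_rat_components:
  assumes "computable F"
  shows "computable (\<lambda>x. rat_pos (F x))" "computable (\<lambda>x. rat_neg (F x))" "computable (\<lambda>x. rat_den (F x))"
  unfolding rat_pos_def rat_neg_def rat_den_def
  by (intro computable_intros computable_half decidable_even assms)+

lemma computable_rat_arith:
  assumes "computable F"
  shows "computable G \<Longrightarrow> computable (\<lambda>x. rat_add (F x) (G x))"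
    "computable G \<Longrightarrow> computable (\<lambda>x. rat_mul (F x) (G x))"
    "computable (\<lambda>x. rat_uminus (F x))"
  unfolding rat_add_def rat_mul_def rat_uminus_def rat_mk_def
  by (intro computable_intros computable_rat_components assms | assumption)+

lemma decidable_rat_less:
  assumes "computable F" "computable G" shows "decidable (\<lambda>x. rat_dec (F x) < rat_dec (G x))"
proof -
  \<comment> \<open>Cross-multiplied, with the negative parts moved to the other side, so that only
    natural numbers are compared.\<close>
  have "decidable (\<lambda>x. rat_pos (F x) * rat_den (G x) + rat_neg (G x) * rat_den (F x)
     < rat_pos (G x) * rat_den (F x) + rat_neg (F x) * rat_den (G x))"
    by (intro computable_intros computable_rat_components assms)
  moreover have "rat_dec a < rat_dec b \<longleftrightarrow>
     rat_pos a * rat_den b + rat_neg b * rat_den a < rat_pos b * rat_den a + rat_neg a * rat_den b" for a b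
  proof -
    have "rat_dec a < rat_dec b \<longleftrightarrow>
      real (rat_pos a * rat_den b + rat_neg b * rat_den a) < real (rat_pos b * rat_den a + rat_neg a * rat_den b)"
      using rat_den_pos[of a] rat_den_pos[of b] unfolding rat_dec_eq
      by (simp add: divide_simps) (simp add: algebra_simps)
    then show ?thesis by (simp only: of_nat_less_iff)
  qed
  ultimately show ?thesis by simp
qed

lemma rat_dec_0 [simp]: "rat_dec 0 = 0"
  by (simp add: rat_dec_eq rat_pos_def rat_neg_def)

lemma rat_dec_of_rat: "\<exists>c. rat_dec c = of_rat q"
proof -
  obtain a b where q: "quotient_of q = (a, b)" by fastforce
  then have "b > 0" "q = of_int a / of_int b"
    using quotient_of_denom_pos[OF q] quotient_of_div[OF q] by auto
  then have "rat_dec (prod_encode (int_encode a, nat b - 1)) = of_rat q"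
    by (simp add: rat_dec_def of_rat_divide)
  then show ?thesis by blast
qed

lemma rat_dec_between: "x < y \<Longrightarrow> \<exists>c. x < rat_dec c \<and> rat_dec c < y"
  using of_rat_dense[of x y] rat_dec_of_rat by metis

definition crat_add :: "nat \<Rightarrow> nat \<Rightarrow> nat" where
  "crat_add a b = prod_encode (rat_add (pfst a) (pfst b), rat_add (psnd a) (psnd b))"
definition crat_mul :: "nat \<Rightarrow> nat \<Rightarrow> nat" where
  "crat_mul a b = prod_encode
     (rat_add (rat_mul (pfst a) (pfst b)) (rat_uminus (rat_mul (psnd a) (psnd b))),
      rat_add (rat_mul (pfst a) (psnd b)) (rat_mul (psnd a) (pfst b)))"
definition crat_nsq :: "nat \<Rightarrow> nat" where
  "crat_nsq a = rat_add (rat_mul (pfst a) (pfst a)) (rat_mul (psnd a) (psnd a))"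

lemma crat_dec_eq: "crat_dec c = Complex (rat_dec (pfst c)) (rat_dec (psnd c))"
  by (simp add: crat_dec_def prod_decode_eq)

lemma crat_dec_arith [simp]:
  "crat_dec (crat_add a b) = crat_dec a + crat_dec b"
  "crat_dec (crat_mul a b) = crat_dec a * crat_dec b"
  "rat_dec (crat_nsq a) = (norm (crat_dec a))\<^sup>2"
  by (simp_all add: crat_dec_eq crat_add_def crat_mul_def crat_nsq_def complex_eq_iff cmod_power2)
    (simp add: power2_eq_square)

lemma computable_crat_arith: "computable2 crat_add" "computable2 crat_mul" "computable crat_nsq"
  unfolding crat_add_def crat_mul_def crat_nsq_def by (intro computable_intros computable_rat_arith)+

text \<open>\<open>conj\<close> is the identity on \<open>\<real>\<close> and complex conjugation on \<open>\<complex>\<close>.\<close>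

locale coded_scalars =
  fixes dec :: "nat \<Rightarrow> 'a::{real_normed_field, euclidean_space}"
    and cadd cmul :: "nat \<Rightarrow> nat \<Rightarrow> nat" and nsq :: "nat \<Rightarrow> nat" and cone :: nat
    and conj :: "'a \<Rightarrow> 'a"
  assumes computable_cadd: "computable2 cadd" and computable_cmul: "computable2 cmul"
    and computable_nsq: "computable nsq"
    and dec_cadd: "dec (cadd a b) = dec a + dec b" and dec_cmul: "dec (cmul a b) = dec a * dec b"
    and dec_nsq: "rat_dec (nsq a) = (norm (dec a))\<^sup>2"
    and dec_0: "dec 0 = 0" and dec_cone: "dec cone = 1"
    and dec_dense: "\<epsilon> > 0 \<Longrightarrow> \<exists>c. norm (dec c - x) < \<epsilon>"
    and conj_add: "conj (x + y) = conj x + conj y" and conj_mult: "conj (x * y) = conj x * conj y"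
    and conj_conj: "conj (conj x) = x"
    and mult_conj: "x * conj x = of_real ((norm x)\<^sup>2)"

lemma rat_dec_dense: "\<epsilon> > 0 \<Longrightarrow> \<exists>c. norm (rat_dec c - x) < \<epsilon>"
proof -
  assume "\<epsilon> > 0"
  then obtain c where "x - \<epsilon> < rat_dec c" "rat_dec c < x + \<epsilon>"
    using rat_dec_between[of "x - \<epsilon>" "x + \<epsilon>"] by auto
  then have "norm (rat_dec c - x) < \<epsilon>" by (simp add: abs_less_iff)
  then show ?thesis by blast
qed

section \<open>Norms of rational vectors over triangular arrays\<close>

lemma list_decode_less: "x \<in> set (list_decode m) \<Longrightarrow> x < m"
proof (induction m arbitrary: x rule: list_decode.induct)
  case (2 n)
  then show ?case using le_prod_encode_1[of "pfst n" "psnd n"] le_prod_encode_2[of "psnd n" "pfst n"]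
    by (force simp: prod_decode_eq)
qed simp

text \<open>Entries are smaller than the code of their list, and components do not exceed the code
  of their pair. Hence the m-th rational vector uses only \<open>R i\<close> with i \<le> m; for
  triangular \<open>R\<close> its coordinates beyond m vanish.\<close>

lemma psnd_code_nth_le: "psnd (code_nth m y) \<le> m"
proof (cases "y < length (list_decode m)")
  case True
  then have "code_nth m y < m" by (simp add: code_nth_def list_decode_less)
  then show ?thesis using le_prod_encode_2[of "psnd (code_nth m y)" "pfst (code_nth m y)"] by simp
qed (simp add: code_nth_def)

lemma rat_vec_eq_sum:
  "rat_vec dec R m k = (\<Sum>y<code_length m. dec (pfst (code_nth m y)) * R (psnd (code_nth m y)) k)"
  unfolding rat_vec_def
  by (simp add: sum_list_sum_nth code_length_def code_nth_def prod_decode_eq lessThan_atLeast0)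

definition triangular :: "(nat \<Rightarrow> nat \<Rightarrow> 'a::zero) \<Rightarrow> bool" where
  "triangular R \<longleftrightarrow> (\<forall>i k. i < k \<longrightarrow> R i k = 0)"

lemma ell2_norm_finite:
  "(\<And>k. k \<ge> n \<Longrightarrow> x k = 0) \<Longrightarrow> ell2_norm x = sqrt (\<Sum>k<n. (norm (x k))\<^sup>2)"
  unfolding ell2_norm_def by (subst suminf_finite[of "{..<n}"]) (auto simp: not_less)

lemma ell2_norm_rat_vec_triangular:
  assumes "triangular R"
  shows "ell2_norm (rat_vec dec R m) = sqrt (\<Sum>k<Suc m. (norm (rat_vec dec R m k))\<^sup>2)"
proof (rule ell2_norm_finite)
  fix k assume "k \<ge> Suc m"
  then have "R (psnd (code_nth m y)) k = 0" for y
    using assms psnd_code_nth_le[of m y] unfolding triangular_def by simp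
  then show "rat_vec dec R m k = 0" by (simp add: rat_vec_eq_sum)
qed

lemma in_rat_interval: "x \<in> rat_interval n \<longleftrightarrow> rat_dec (pfst n) < x \<and> x < rat_dec (psnd n)"
  by (simp add: rat_interval_def prod_decode_eq)

context coded_scalars begin

text \<open>With coded scalars as entries the squared norm is a finite sum of rationals, computed
  exactly, so comparing the norm with rational end points is decidable and not merely semidecidable.
  The array may depend on the input \<open>x\<close>.\<close>

lemma decidable_norm_in_rat_interval:
  assumes L: "computable3 L" and "\<And>x. triangular (\<lambda>i k. dec (L x i k))"
    and "computable m" "computable n"
  shows "decidable (\<lambda>x. ell2_norm (rat_vec dec (\<lambda>i k. dec (L x i k)) (m x)) \<in> rat_interval (n x))"
proof -
  define V where "V x k = rec_nat 0 (\<lambda>y r. cadd r (cmul (pfst (code_nth (m x) y))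
     (L x (psnd (code_nth (m x) y)) k))) (code_length (m x))" for x k
  define s where "s x = rec_nat 0 (\<lambda>k r. rat_add r (nsq (V x k))) (Suc (m x))" for x
  have "computable (\<lambda>p. V (pfst p) (psnd p))"
    unfolding V_def
    by (rule computable_rec)
      (intro computable_intros computable2_comp[OF computable_cadd] computable2_comp[OF computable_cmul]
        computable3_comp[OF L] computable_code_nth computable_code_length
        computable_comp[OF \<open>computable m\<close>])+
  then have V: "computable2 V" by (rule computable2I)
  have s: "computable s" unfolding s_def
    by (rule computable_rec)
      (intro computable_intros computable_rat_arith computable_comp[OF computable_nsq]
        computable2_comp[OF V] \<open>computable m\<close>)+
  have "dec (rec_nat 0 (\<lambda>y r. cadd r (cmul (A y) (B y))) l) = (\<Sum>y<l. dec (A y) * dec (B y))" for A B l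
    by (induction l) (auto simp: dec_0 dec_cadd dec_cmul)
  then have dV: "dec (V x k) = rat_vec dec (\<lambda>i k. dec (L x i k)) (m x) k" for x k
    unfolding V_def rat_vec_eq_sum .
  have "rat_dec (rec_nat 0 (\<lambda>k r. rat_add r (nsq (A k))) l) = (\<Sum>y<l. (norm (dec (A y)))\<^sup>2)" for A l
    by (induction l) (auto simp: dec_nsq)
  then have "rat_dec (s x) = (\<Sum>k<Suc (m x). (norm (dec (V x k)))\<^sup>2)" for x unfolding s_def .
  then have norm: "ell2_norm (rat_vec dec (\<lambda>i k. dec (L x i k)) (m x)) = sqrt (rat_dec (s x))"
    and s0: "rat_dec (s x) \<ge> 0" for x
    using ell2_norm_rat_vec_triangular[OF assms(2)[of x], of dec "m x"] dV by (auto simp: sum_nonneg)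
  \<comment> \<open>Squaring is valid only after a case distinction on the signs of the end
    points.\<close>
  have *: "(a < sqrt r \<and> sqrt r < b) \<longleftrightarrow> (a < 0 \<or> a * a < r) \<and> (0 < b \<and> r < b * b)" if "r \<ge> 0" for a b r :: real
  proof -
    have "a < sqrt r \<longleftrightarrow> a < 0 \<or> a * a < r"
      using that real_less_rsqrt[of a r] real_sqrt_ge_zero[of r]
      by (smt (verit) power2_eq_square real_sqrt_less_mono real_sqrt_abs)
    moreover have "sqrt r < b \<longleftrightarrow> 0 < b \<and> r < b * b"
      using that real_sqrt_ge_zero[of r]
      by (smt (verit) power2_eq_square real_sqrt_less_mono real_sqrt_abs real_less_lsqrt)
    ultimately show ?thesis by blast
  qed
  have "decidable (\<lambda>x. (rat_dec (pfst (n x)) < rat_dec 0 \<or> rat_dec (rat_mul (pfst (n x)) (pfst (n x))) < rat_dec (s x)) \<and>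
     (rat_dec 0 < rat_dec (psnd (n x)) \<and> rat_dec (s x) < rat_dec (rat_mul (psnd (n x)) (psnd (n x)))))"
    by (intro computable_intros decidable_rat_less computable_rat_arith s \<open>computable n\<close>)
  then show ?thesis unfolding in_rat_interval norm *[OF s0] by simp
qed

end

section \<open>Linear algebra and the space of square-summable sequences\<close>

text \<open>Gaussian elimination, removing one equation and one pivot unknown at a time. The field
  is arbitrary because the lemma is applied both over the reals and over the scalars.\<close>

lemma exists_nontrivial_solution:
  fixes u :: "'i \<Rightarrow> 'c \<Rightarrow> 'f::field"
  assumes "finite A" "finite I" "card A < card I"
  shows "\<exists>c. (\<exists>j\<in>I. c j \<noteq> 0) \<and> (\<forall>a\<in>A. (\<Sum>j\<in>I. c j * u j a) = 0)"
  using assms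
proof (induction A arbitrary: I u rule: finite_induct)
  case empty
  then obtain j where "j \<in> I" by (metis card.empty ex_in_conv less_irrefl)
  then show ?case by (intro exI[of _ "\<lambda>_. 1"]) auto
next
  case (insert a A)
  show ?case
  proof (cases "\<forall>j\<in>I. u j a = 0")
    case True
    have "card A < card I" using insert by simp
    from insert.IH[OF insert.prems(1) this, of u] obtain c where
      "\<exists>j\<in>I. c j \<noteq> 0" "\<forall>b\<in>A. (\<Sum>j\<in>I. c j * u j b) = 0" by blast
    then show ?thesis using True by (intro exI[of _ c]) simp
  next
    case False
    then obtain p where p: "p \<in> I" "u p a \<noteq> 0" by blast
    define I' where "I' = I - {p}"
    have I': "finite I'" "card A < card I'" "I = insert p I'" "p \<notin> I'"
      using insert p by (auto simp: I'_def)
    obtain c where c: "\<exists>j\<in>I'. c j \<noteq> 0"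
      "\<And>b. b \<in> A \<Longrightarrow> (\<Sum>j\<in>I'. c j * (u j b - u j a / u p a * u p b)) = 0"
      using insert.IH[OF I'(1,2), of "\<lambda>j b. u j b - u j a / u p a * u p b"] by blast
    \<comment> \<open>Giving the pivot the coefficient \<open>- t\<close> makes equation
      \<open>a\<close> hold; the eliminated system then yields the others.\<close>
    define t where "t = (\<Sum>j\<in>I'. c j * u j a) / u p a"
    have eq: "(\<Sum>j\<in>I. (c(p := - t)) j * u j b) = (\<Sum>j\<in>I'. c j * u j b) - t * u p b" for b
    proof -
      have "(\<Sum>j\<in>I'. (c(p := - t)) j * u j b) = (\<Sum>j\<in>I'. c j * u j b)"
        by (rule sum.cong) (use I'(4) in auto)
      then show ?thesis using I' by simp
    qed
    have "(\<Sum>j\<in>I. (c(p := - t)) j * u j b) = 0" if b: "b \<in> insert a A" for b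
    proof (cases "b = a")
      case True
      then show ?thesis unfolding eq using p by (simp add: t_def)
    next
      case False
      then have "0 = (\<Sum>j\<in>I'. c j * (u j b - u j a / u p a * u p b))" using c(2) b by simp
      also have "\<dots> = (\<Sum>j\<in>I'. c j * u j b) - t * u p b"
        unfolding t_def
        by (simp add: right_diff_distrib sum_subtractf sum_divide_distrib sum_distrib_right mult.assoc)
      finally show ?thesis unfolding eq by simp
    qed
    moreover have "\<exists>j\<in>I. (c(p := - t)) j \<noteq> 0" using c(1) I' by auto
    ultimately show ?thesis by blast
  qed
qed

text \<open>Separating the positive from the negative coefficients of a linear dependence among all vectors but one
  gives a vector \<open>v\<close> with \<open>\<langle>v, v\<rangle> \<le> 0\<close>, and pairing \<open>v = 0\<close> with the remaining vector is a contradiction.\<close>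

lemma obtuse_dim_le:
  fixes u :: "nat \<Rightarrow> nat \<Rightarrow> 'a::euclidean_space"
  assumes neg: "\<And>i j. i < j \<Longrightarrow> j \<le> K \<Longrightarrow> (\<Sum>k<n. u i k \<bullet> u j k) < 0"
  shows "K \<le> n * DIM('a)"
proof (rule ccontr)
  assume "\<not> K \<le> n * DIM('a)"
  \<comment> \<open>The vectors with index below \<open>K\<close> already outnumber the real
    coordinates; \<open>u K\<close> is set aside for the final pairing.\<close>
  then have card: "card ({..<n} \<times> (Basis::'a set)) < card {..<K}"
    unfolding card_cartesian_product card_lessThan by linarith
  have "finite ({..<n} \<times> (Basis::'a set))" "finite {..<K}" by simp_all
  from exists_nontrivial_solution[OF this card, of "\<lambda>j a. u j (fst a) \<bullet> snd a"]
  obtain c where c0: "\<exists>j\<in>{..<K}. c j \<noteq> 0"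
      "\<forall>a\<in>{..<n} \<times> (Basis::'a set). (\<Sum>j<K. c j * (u j (fst a) \<bullet> snd a)) = 0"
    by blast
  have c: "\<exists>j<K. c j \<noteq> 0" using c0(1) by blast
  have c2: "(\<Sum>j<K. c j * (u j k \<bullet> b)) = 0" if "k < n" "b \<in> Basis" for k b
    using bspec[OF c0(2), of "(k, b)"] that by simp
  define B where "B x y = (\<Sum>k<n. x k \<bullet> y k)" for x y :: "nat \<Rightarrow> 'a"
  define v where "v P k = (\<Sum>j\<in>P. c j *\<^sub>R u j k)" for P k
  have Bv: "B (v P) y = (\<Sum>j\<in>P. c j * B (u j) y)" for P y
  proof -
    have "B (v P) y = (\<Sum>k<n. \<Sum>j\<in>P. c j * (u j k \<bullet> y k))"
      unfolding B_def v_def by (simp add: inner_sum_left)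
    also have "\<dots> = (\<Sum>j\<in>P. \<Sum>k<n. c j * (u j k \<bullet> y k))" by (rule sum.swap)
    finally show ?thesis unfolding B_def by (simp add: sum_distrib_left)
  qed
  have Bc: "B x y = B y x" for x y unfolding B_def by (simp add: inner_commute)
  define P where "P = {j. j < K \<and> c j > 0}"
  define M where "M = {j. j < K \<and> c j < 0}"
  have fin: "finite P" "finite M" by (auto simp: P_def M_def)
  have vsum: "v P k + v M k = 0" if "k < n" for k
  proof -
    have "v P k + v M k = (\<Sum>j\<in>P \<union> M. c j *\<^sub>R u j k)"
      unfolding v_def by (rule sum.union_disjoint[symmetric]) (use fin in \<open>auto simp: P_def M_def\<close>)
    also have "\<dots> = (\<Sum>j<K. c j *\<^sub>R u j k)"
    proof (rule sum.mono_neutral_left)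
      show "P \<union> M \<subseteq> {..<K}" unfolding P_def M_def by blast
      show "\<forall>j\<in>{..<K} - (P \<union> M). c j *\<^sub>R u j k = 0" unfolding P_def M_def by auto
    qed simp
    also have "\<dots> = 0" using c2[OF that] by (simp add: euclidean_eq_iff[where 'a = 'a] inner_sum_left)
    finally show ?thesis .
  qed
  have neg': "B (u i) (u j) < 0" if "i \<noteq> j" "i \<le> K" "j \<le> K" for i j
    using neg[of i j] neg[of j i] that Bc[of "u i" "u j"] unfolding B_def
    by (cases "i < j") auto
  \<comment> \<open>Each term multiplies coefficients of opposite sign by a negative inner
    product.\<close>
  have "B (v P) (v M) \<ge> 0"
  proof -
    have "B (v P) (v M) = (\<Sum>i\<in>P. \<Sum>j\<in>M. (c i * c j) * B (u j) (u i))"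
      unfolding Bv[of P] Bc[of "u i" "v M" for i] Bv[of M] by (simp add: sum_distrib_left mult.assoc)
    also have "\<dots> \<ge> 0"
    proof (intro sum_nonneg)
      fix i j assume ij: "i \<in> P" "j \<in> M"
      then have "j \<noteq> i" by (auto simp: P_def M_def)
      with ij show "c i * c j * B (u j) (u i) \<ge> 0" using neg'[of j i]
        by (simp add: P_def M_def zero_le_mult_iff mult_le_0_iff less_imp_le)
    qed
    finally show ?thesis .
  qed
  have "v M k = - v P k" if "k < n" for k using vsum[OF that] by (simp add: add_eq_0_iff)
  then have vM: "B x (v M) = - B x (v P)" for x unfolding B_def by (simp add: sum_negf)
  with \<open>B (v P) (v M) \<ge> 0\<close> have "B (v P) (v P) \<le> 0" by simp
  then have "v P k = 0" if "k < n" for k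
  proof -
    have "(\<Sum>k<n. v P k \<bullet> v P k) = 0"
      using \<open>B (v P) (v P) \<le> 0\<close> sum_nonneg[of "{..<n}" "\<lambda>k. v P k \<bullet> v P k"] unfolding B_def by simp
    then show ?thesis using that by (simp add: sum_nonneg_eq_0_iff)
  qed
  then have vP0: "B x (v P) = 0" for x unfolding B_def by simp
  have "P = {}"
  proof (rule ccontr)
    assume "P \<noteq> {}"
    then have "(\<Sum>j\<in>P. - (c j * B (u j) (u K))) > 0"
      by (intro sum_pos) (use fin neg'[of _ K] in \<open>auto simp: P_def intro!: mult_pos_neg\<close>)
    then have "(\<Sum>j\<in>P. c j * B (u j) (u K)) < 0" by (simp add: sum_negf)
    then show False using vP0[of "u K"] Bc[of "u K" "v P"] Bv[of P "u K"] by linarith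
  qed
  moreover have "M = {}"
  proof (rule ccontr)
    assume "M \<noteq> {}"
    then have "(\<Sum>j\<in>M. c j * B (u j) (u K)) > 0"
      by (intro sum_pos) (use fin neg'[of _ K] in \<open>auto simp: M_def intro!: mult_neg_neg\<close>)
    then show False using vP0[of "u K"] vM[of "u K"] Bc[of "u K" "v M"] Bv[of M "u K"] by linarith
  qed
  ultimately show False using c unfolding P_def M_def by (auto simp: neq_iff)
qed

text \<open>In an orthonormal real basis of size K, take the basis vectors shifted by -\<delta> in
  every coordinate, with \<delta> = 1 / (2 K), and as last vector the one with all coordinates -1.
  Two shifted vectors have inner product K \<delta>\<delta> - 2 \<delta> = -3 \<delta> / 2, and each
  has inner product K \<delta> - 1 = -1/2 with the last.\<close>

lemma exists_obtuse:
  assumes "n > 0"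
  shows "\<exists>u :: nat \<Rightarrow> nat \<Rightarrow> 'a::euclidean_space. (\<forall>j k. k \<ge> n \<longrightarrow> u j k = 0) \<and>
     (\<forall>i j. i < j \<longrightarrow> j \<le> n * DIM('a) \<longrightarrow> (\<Sum>k<n. u i k \<bullet> u j k) < 0)"
proof -
  define A where "A = {..<n} \<times> (Basis::'a set)"
  define K where "K = n * DIM('a)"
  have K: "card A = K" "finite A" "K > 0" using assms by (auto simp: A_def K_def)
  then obtain \<phi> where \<phi>: "bij_betw \<phi> {..<K} A"
    using ex_bij_betw_nat_finite[of A] by (auto simp: atLeast0LessThan)
  define g where "g j q = (if j < K then of_bool (\<phi> j = q) - 1 / (2 * real K) else - 1)" for j q
  define u where "u j k = (if k < n then \<Sum>b\<in>Basis. g j (k, b) *\<^sub>R b else (0::'a))" for j k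
  have uu: "(\<Sum>k<n. u i k \<bullet> u j k) = (\<Sum>q\<in>A. g i q * g j q)" for i j
  proof -
    have "(\<Sum>k<n. u i k \<bullet> u j k) = (\<Sum>k<n. \<Sum>b\<in>Basis. g i (k, b) * g j (k, b))"
      by (rule sum.cong) (auto simp: u_def inner_sum_left inner_sum_right inner_Basis if_distrib sum.delta mult.commute cong: if_cong)
    also have "\<dots> = (\<Sum>q\<in>A. g i q * g j q)" unfolding A_def by (simp add: sum.cartesian_product case_prod_beta)
    finally show ?thesis .
  qed
  define \<delta> where "\<delta> = 1 / (2 * real K)"
  have \<delta>: "real K * \<delta> = 1 / 2" "\<delta> > 0" using K by (auto simp: \<delta>_def)
  have neg: "(\<Sum>k<n. u i k \<bullet> u j k) < 0" if "i < j" "j \<le> K" for i j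
  proof -
    have \<phi>i: "\<phi> i \<in> A" using \<phi> that by (auto simp: bij_betw_def)
    have one: "(\<Sum>q\<in>A. of_bool (\<phi> i = q)) = (1::real)" using \<phi>i K by simp
    show ?thesis
    proof (cases "j = K")
      case True
      have "(\<Sum>q\<in>A. g i q * g j q) = (\<Sum>q\<in>A. \<delta> - of_bool (\<phi> i = q))"
        using that True by (intro sum.cong) (auto simp: g_def \<delta>_def)
      also have "\<dots> = - 1 / 2" using one \<delta> K by (simp add: sum_subtractf)
      finally show ?thesis unfolding uu by simp
    next
      case False
      then have jK: "j < K" "\<phi> j \<in> A" using \<phi> that by (auto simp: bij_betw_def)
      have ne: "\<phi> i \<noteq> \<phi> j" using \<phi> that jK by (auto simp: bij_betw_def inj_on_def)
      have one': "(\<Sum>q\<in>A. of_bool (\<phi> j = q)) = (1::real)" using jK K by simp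
      have "(\<Sum>q\<in>A. g i q * g j q) = (\<Sum>q\<in>A. \<delta> * \<delta> - \<delta> * of_bool (\<phi> i = q) - \<delta> * of_bool (\<phi> j = q))"
        using that jK ne by (intro sum.cong) (auto simp: g_def \<delta>_def algebra_simps)
      also have "\<dots> = (real K * \<delta>) * \<delta> - \<delta> - \<delta>"
        using one one' K by (simp add: sum_subtractf sum_distrib_left[symmetric])
      also have "\<dots> < 0" using \<delta> by simp
      finally show ?thesis unfolding uu .
    qed
  qed
  show ?thesis by (rule exI[of _ u]) (use neg in \<open>auto simp: u_def K_def\<close>)
qed

section \<open>The norm of square-summable sequences and finite linear spans\<close>

lemma ell2_norm_nonneg: "x \<in> ell2 \<Longrightarrow> ell2_norm x \<ge> 0"
  unfolding ell2_norm_def ell2_def by (auto intro: suminf_nonneg)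

lemma ell2_norm_square: "x \<in> ell2 \<Longrightarrow> (ell2_norm x)\<^sup>2 = (\<Sum>i. (norm (x i))\<^sup>2)"
  unfolding ell2_norm_def ell2_def by (auto intro!: real_sqrt_pow2 suminf_nonneg)

lemma ell2_add:
  assumes "x \<in> ell2" "y \<in> ell2"
  shows "(\<lambda>k. x k + y k) \<in> ell2" "ell2_norm (\<lambda>k. x k + y k) \<le> ell2_norm x + ell2_norm y"
proof -
  have L: "L2_set (\<lambda>k. norm (z k)) {..<n} \<le> ell2_norm z" if "z \<in> ell2" for z :: "nat \<Rightarrow> 'a" and n
    unfolding L2_set_def ell2_norm_def using that
    by (intro real_sqrt_le_mono sum_le_suminf) (auto simp: ell2_def)
  have *: "(\<Sum>k<n. (norm (x k + y k))\<^sup>2) \<le> (ell2_norm x + ell2_norm y)\<^sup>2" for n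
  proof -
    have "L2_set (\<lambda>k. norm (x k + y k)) {..<n} \<le> L2_set (\<lambda>k. norm (x k) + norm (y k)) {..<n}"
      by (rule L2_set_mono) (auto intro: norm_triangle_ineq)
    also have "\<dots> \<le> L2_set (\<lambda>k. norm (x k)) {..<n} + L2_set (\<lambda>k. norm (y k)) {..<n}"
      by (rule L2_set_triangle_ineq)
    also have "\<dots> \<le> ell2_norm x + ell2_norm y" using L assms by (intro add_mono)
    finally have "sqrt (\<Sum>k<n. (norm (x k + y k))\<^sup>2) \<le> ell2_norm x + ell2_norm y" unfolding L2_set_def .
    then show ?thesis by (rule sqrt_le_D)
  qed
  have s: "summable (\<lambda>k. (norm (x k + y k))\<^sup>2)"
    by (rule summableI_nonneg_bounded[OF _ *]) auto
  then show "(\<lambda>k. x k + y k) \<in> ell2" by (simp add: ell2_def)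
  have "(\<Sum>k. (norm (x k + y k))\<^sup>2) \<le> (ell2_norm x + ell2_norm y)\<^sup>2"
    by (rule suminf_le_const[OF s *])
  then show "ell2_norm (\<lambda>k. x k + y k) \<le> ell2_norm x + ell2_norm y"
    unfolding ell2_norm_def[of "\<lambda>k. x k + y k"]
    using ell2_norm_nonneg assms by (intro real_le_lsqrt) (auto intro!: suminf_nonneg[OF s] add_nonneg_nonneg)
qed

lemma ell2_scale:
  assumes "x \<in> ell2"
  shows "(\<lambda>k. c * x k) \<in> ell2" "ell2_norm (\<lambda>k. c * x k) = norm c * ell2_norm x"
  using assms by (auto simp: ell2_def ell2_norm_def norm_mult power_mult_distrib suminf_mult real_sqrt_mult
     summable_mult)

lemma ell2_zero: "(\<lambda>k. 0) \<in> ell2"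
  by (simp add: ell2_def)

lemma ell2_diff:
  assumes "x \<in> ell2" "y \<in> ell2"
  shows "(\<lambda>k. x k - y k) \<in> ell2" "ell2_norm x \<le> ell2_norm y + ell2_norm (\<lambda>k. x k - y k)"
proof -
  show d: "(\<lambda>k. x k - y k) \<in> ell2"
    using ell2_add(1)[OF assms(1) ell2_scale(1)[OF assms(2), of "-1"]] by simp
  show "ell2_norm x \<le> ell2_norm y + ell2_norm (\<lambda>k. x k - y k)"
    using ell2_add(2)[OF assms(2) d] by simp
qed

lemma ell2_norm_diff_commute: "ell2_norm (\<lambda>k. x k - y k) = ell2_norm (\<lambda>k. y k - x k)"
  by (simp add: ell2_norm_def norm_minus_commute)

lemma ell2_norm_diff_le:
  assumes "x \<in> ell2" "y \<in> ell2"
  shows "\<bar>ell2_norm x - ell2_norm y\<bar> \<le> ell2_norm (\<lambda>k. x k - y k)"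
  using ell2_diff(2)[OF assms] ell2_diff(2)[OF assms(2,1)] ell2_norm_diff_commute[of x y] by linarith

lemma ell2_sum: "(\<And>j. j \<in> A \<Longrightarrow> x j \<in> ell2) \<Longrightarrow> (\<lambda>k. \<Sum>j\<in>A. c j * x j k) \<in> ell2"
proof (induction A rule: infinite_finite_induct)
  case (insert a A)
  then show ?case using ell2_add(1)[OF ell2_scale(1)[of "x a" "c a"], of "\<lambda>k. \<Sum>j\<in>A. c j * x j k"] by simp
qed (auto simp: ell2_zero)

lemma ell2_finite_support: "(\<And>k. k \<ge> n \<Longrightarrow> x k = 0) \<Longrightarrow> x \<in> ell2"
  unfolding ell2_def by (auto intro!: summable_finite[of "{..<n}"]) (metis not_less)

lemma ell2_norm_eq_0:
  assumes "x \<in> ell2" "ell2_norm x = 0" shows "x k = 0"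
proof -
  have "(\<Sum>i. (norm (x i))\<^sup>2) = 0" using ell2_norm_square[OF assms(1)] assms(2) by simp
  then show ?thesis using suminf_eq_zero_iff[of "\<lambda>i. (norm (x i))\<^sup>2"] assms(1) by (auto simp: ell2_def)
qed

lemma norm_le_ell2_norm:
  assumes "x \<in> ell2" shows "norm (x k) \<le> ell2_norm x"
proof -
  have "(\<Sum>i\<in>{k}. (norm (x i))\<^sup>2) \<le> (\<Sum>i. (norm (x i))\<^sup>2)"
    using assms by (intro sum_le_suminf) (auto simp: ell2_def)
  then show ?thesis unfolding ell2_norm_def by (intro real_le_rsqrt) simp
qed

lemma ell2_truncate:
  assumes "x \<in> ell2" "\<epsilon> > 0"
  shows "\<exists>n. ell2_norm (\<lambda>k. x k - (if k < n then x k else 0)) < \<epsilon>"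
proof -
  have s: "summable (\<lambda>i. (norm (x i))\<^sup>2)" using assms by (simp add: ell2_def)
  obtain n where n: "norm (\<Sum>i. (norm (x (i + n)))\<^sup>2) < \<epsilon>\<^sup>2"
    using suminf_exist_split[OF _ s, of "\<epsilon>\<^sup>2"] assms by auto
  let ?y = "\<lambda>k. x k - (if k < n then x k else 0)"
  have y: "summable (\<lambda>i. (norm (?y i))\<^sup>2)"
    by (rule summable_comparison_test'[OF s, of 0]) auto
  have "(\<Sum>i. (norm (?y i))\<^sup>2) = (\<Sum>i. (norm (?y (i + n)))\<^sup>2) + (\<Sum>i<n. (norm (?y i))\<^sup>2)"
    by (rule suminf_split_initial_segment[OF y])
  also have "\<dots> = (\<Sum>i. (norm (x (i + n)))\<^sup>2)" by simp
  finally have "(\<Sum>i. (norm (?y i))\<^sup>2) < \<epsilon>\<^sup>2" using n by simp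
  then have "ell2_norm ?y < sqrt (\<epsilon>\<^sup>2)" unfolding ell2_norm_def by (rule real_sqrt_less_mono)
  then show ?thesis using assms by auto
qed

text \<open>Polarization. Over the complex numbers \<open>\<bullet>\<close> is the real part of the
  scalar product, so its sign can be read off from three norms.\<close>

lemma ell2_norm_square_add:
  fixes x y :: "nat \<Rightarrow> 'a::{real_normed_field, euclidean_space}"
  assumes "\<And>k. k \<ge> n \<Longrightarrow> x k = 0" "\<And>k. k \<ge> n \<Longrightarrow> y k = 0"
  shows "(ell2_norm (\<lambda>k. x k + y k))\<^sup>2 = (ell2_norm x)\<^sup>2 + (ell2_norm y)\<^sup>2 + 2 * (\<Sum>k<n. x k \<bullet> y k)"
proof -
  have *: "(ell2_norm z)\<^sup>2 = (\<Sum>k<n. z k \<bullet> z k)" if "\<And>k. k \<ge> n \<Longrightarrow> z k = 0" for z :: "nat \<Rightarrow> 'a"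
    using ell2_norm_finite[OF that] by (simp add: sum_nonneg power2_norm_eq_inner)
  have "(ell2_norm (\<lambda>k. x k + y k))\<^sup>2 = (\<Sum>k<n. (x k + y k) \<bullet> (x k + y k))"
    by (rule *) (use assms in auto)
  also have "\<dots> = (\<Sum>k<n. x k \<bullet> x k) + (\<Sum>k<n. y k \<bullet> y k) + 2 * (\<Sum>k<n. x k \<bullet> y k)"
    by (simp add: inner_add_left inner_add_right sum.distrib sum_distrib_left inner_commute algebra_simps)
  finally show ?thesis using *[OF assms(1)] *[OF assms(2)] by simp
qed

definition lspan :: "(nat \<Rightarrow> nat \<Rightarrow> 'a::comm_ring_1) \<Rightarrow> (nat \<Rightarrow> 'a) set" where
  "lspan R = {x. \<exists>n a. x = (\<lambda>k. \<Sum>i<n. a i * R i k)}"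

lemma lspan_add:
  assumes "x \<in> lspan R" "y \<in> lspan R" shows "(\<lambda>k. x k + y k) \<in> lspan R"
proof -
  obtain n a where x: "x = (\<lambda>k. \<Sum>i<n. a i * R i k)" using assms(1) by (auto simp: lspan_def)
  obtain m b where y: "y = (\<lambda>k. \<Sum>i<m. b i * R i k)" using assms(2) by (auto simp: lspan_def)
  have pad: "(\<Sum>i<n. a i * R i k) = (\<Sum>i<l. (if i < n then a i else 0) * R i k)" if "n \<le> l" for a n k l
    using that by (intro sum.mono_neutral_cong_left) auto
  have "(\<lambda>k. x k + y k) = (\<lambda>k. \<Sum>i<max n m. ((if i < n then a i else 0) + (if i < m then b i else 0)) * R i k)"
    unfolding x y using pad[of n "max n m" a] pad[of m "max n m" b]
    by (simp add: distrib_right sum.distrib)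
  then show ?thesis unfolding lspan_def mem_Collect_eq by (intro exI)
qed

lemma lspan_scale: "x \<in> lspan R \<Longrightarrow> (\<lambda>k. c * x k) \<in> lspan R"
proof -
  assume "x \<in> lspan R"
  then obtain n a where "x = (\<lambda>k. \<Sum>i<n. a i * R i k)" by (auto simp: lspan_def)
  then have "(\<lambda>k. c * x k) = (\<lambda>k. \<Sum>i<n. (c * a i) * R i k)" by (simp add: sum_distrib_left mult.assoc)
  then show ?thesis unfolding lspan_def mem_Collect_eq by (intro exI)
qed

lemma lspan_base: "R i \<in> lspan R"
proof -
  have "R i = (\<lambda>k. \<Sum>j<Suc i. of_bool (j = i) * R j k)" by (simp add: sum.delta)
  then show ?thesis unfolding lspan_def mem_Collect_eq by (intro exI)
qed

lemma lspan_sum: "(\<And>j. j \<in> A \<Longrightarrow> x j \<in> lspan R) \<Longrightarrow> (\<lambda>k. \<Sum>j\<in>A. c j * x j k) \<in> lspan R"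
proof (induction A rule: infinite_finite_induct)
  case (insert a A)
  then show ?case using lspan_add[OF lspan_scale[of "x a" R "c a"], of "\<lambda>k. \<Sum>j\<in>A. c j * x j k"] by simp
qed (auto simp: lspan_def intro!: exI[of _ "0::nat"])

section \<open>Conjugation and the inner product\<close>

context coded_scalars begin

lemma conj_0 [simp]: "conj 0 = 0"
  using conj_add[of 0 0] by simp

lemma conj_minus: "conj (- x) = - conj x"
  using conj_add[of x "- x"] by (simp add: eq_neg_iff_add_eq_0 add.commute)

lemma norm_conj [simp]: "norm (conj x) = norm x"
proof (cases "x = 0")
  case False
  have "norm x * norm (conj x) = norm x * norm x"
    using arg_cong[OF mult_conj[of x], of norm] by (simp add: norm_mult power2_eq_square)
  then show ?thesis using False by simp
qed simp

text \<open>A nonnegative real r is s times the conjugate of s for s the square root of r, and such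
  a product is self-conjugate.\<close>

lemma conj_of_real [simp]: "conj (of_real r) = of_real r"
proof -
  have *: "conj (of_real r) = of_real r" if "r \<ge> 0" for r
  proof -
    let ?s = "of_real (sqrt r) :: 'a"
    have s: "?s * conj ?s = of_real r" using mult_conj[of ?s] that by simp
    have "conj (?s * conj ?s) = ?s * conj ?s" by (simp add: conj_mult conj_conj mult.commute)
    then show ?thesis unfolding s .
  qed
  show ?thesis
  proof (cases "r \<ge> 0")
    case False
    then show ?thesis using *[of "- r"] conj_minus[of "of_real (- r)"] by simp
  qed (rule *)
qed

lemma bounded_linear_conj: "bounded_linear conj"
proof (rule bounded_linear_intro[where K = 1])
  show "conj (r *\<^sub>R x) = r *\<^sub>R conj x" for r x by (simp add: scaleR_conv_of_real conj_mult)
qed (auto simp: conj_add)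

lemma conj_sum: "conj (\<Sum>i\<in>A. f i) = (\<Sum>i\<in>A. conj (f i))"
  by (induction A rule: infinite_finite_induct) (auto simp: conj_add)

definition ip :: "(nat \<Rightarrow> 'a) \<Rightarrow> (nat \<Rightarrow> 'a) \<Rightarrow> 'a" where
  "ip x y = (\<Sum>k. x k * conj (y k))"

lemma summable_ip:
  assumes "x \<in> ell2" "y \<in> ell2" shows "summable (\<lambda>k. x k * conj (y k))"
proof (rule summable_comparison_test')
  show "summable (\<lambda>k. (norm (x k))\<^sup>2 + (norm (y k))\<^sup>2)"
    using assms by (auto simp: ell2_def intro: summable_add)
  show "norm (x k * conj (y k)) \<le> (norm (x k))\<^sup>2 + (norm (y k))\<^sup>2" for k
  proof -
    have "0 \<le> norm (x k) * norm (y k)" by simp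
    then show ?thesis using sum_squares_bound[of "norm (x k)" "norm (y k)"] unfolding norm_mult norm_conj
      by linarith
  qed
qed

lemma ip_add_left: "x \<in> ell2 \<Longrightarrow> y \<in> ell2 \<Longrightarrow> z \<in> ell2 \<Longrightarrow> ip (\<lambda>k. x k + y k) z = ip x z + ip y z"
  unfolding ip_def by (simp add: distrib_right suminf_add summable_ip)

lemma ip_scale_left: "x \<in> ell2 \<Longrightarrow> z \<in> ell2 \<Longrightarrow> ip (\<lambda>k. c * x k) z = c * ip x z"
  unfolding ip_def by (simp add: mult.assoc suminf_mult summable_ip)

lemma ip_commute: "x \<in> ell2 \<Longrightarrow> y \<in> ell2 \<Longrightarrow> ip y x = conj (ip x y)"
  unfolding ip_def
  using bounded_linear.suminf[OF bounded_linear_conj summable_ip[of x y]]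
  by (simp add: conj_mult conj_conj mult.commute)

lemma ip_zero_left [simp]: "ip (\<lambda>k. 0) z = 0"
  by (simp add: ip_def)

lemma ip_sum_left:
  assumes "\<And>j. j \<in> A \<Longrightarrow> x j \<in> ell2" "z \<in> ell2"
  shows "ip (\<lambda>k. \<Sum>j\<in>A. c j * x j k) z = (\<Sum>j\<in>A. c j * ip (x j) z)"
  using assms
proof (induction A rule: infinite_finite_induct)
  case (insert a A)
  then show ?case
    using ip_add_left[OF ell2_scale(1)[of "x a" "c a"] ell2_sum[of A x c], of z] ip_scale_left[of "x a" z "c a"]
    by simp
qed auto

lemma ip_sum_right:
  assumes "\<And>j. j \<in> A \<Longrightarrow> x j \<in> ell2" "z \<in> ell2"
  shows "ip z (\<lambda>k. \<Sum>j\<in>A. c j * x j k) = (\<Sum>j\<in>A. conj (c j) * ip z (x j))"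
proof -
  have "ip z (\<lambda>k. \<Sum>j\<in>A. c j * x j k) = conj (\<Sum>j\<in>A. c j * ip (x j) z)"
    using assms by (subst ip_commute[of _ z]) (auto simp: ip_sum_left intro!: ell2_sum)
  also have "\<dots> = (\<Sum>j\<in>A. conj (c j) * ip z (x j))"
    unfolding conj_sum by (intro sum.cong refl) (use assms ip_commute[of _ z] in \<open>simp add: conj_mult\<close>)
  finally show ?thesis .
qed

lemma ip_diff_left:
  assumes "x \<in> ell2" "y \<in> ell2" "z \<in> ell2" shows "ip (\<lambda>k. x k - y k) z = ip x z - ip y z"
  using ip_add_left[OF assms(1) ell2_scale(1)[OF assms(2), of "-1"] assms(3)]
    ip_scale_left[OF assms(2,3), of "-1"] by simp

lemma ip_self: "x \<in> ell2 \<Longrightarrow> ip x x = of_real ((ell2_norm x)\<^sup>2)"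
  unfolding ip_def mult_conj by (simp add: ell2_norm_square suminf_of_real ell2_def)

text \<open>Finite Parseval identity, the reason why passing to coordinates is isometric.\<close>

lemma ell2_norm_orthonormal_sum:
  assumes "finite K" "\<And>k. k \<in> K \<Longrightarrow> \<beta> k \<in> ell2"
    "\<And>k l. k \<in> K \<Longrightarrow> l \<in> K \<Longrightarrow> ip (\<beta> k) (\<beta> l) = of_bool (k = l)"
  shows "(ell2_norm (\<lambda>j. \<Sum>k\<in>K. a k * \<beta> k j))\<^sup>2 = (\<Sum>k\<in>K. (norm (a k))\<^sup>2)"
proof -
  let ?v = "\<lambda>j. \<Sum>k\<in>K. a k * \<beta> k j"
  have v: "?v \<in> ell2" by (rule ell2_sum) (use assms in auto)
  have "of_real ((ell2_norm ?v)\<^sup>2) = ip ?v ?v" using ip_self[OF v] by simp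
  also have "\<dots> = (\<Sum>k\<in>K. a k * (\<Sum>l\<in>K. conj (a l) * ip (\<beta> k) (\<beta> l)))"
    by (subst ip_sum_left) (use assms v in \<open>auto simp: ip_sum_right cong: sum.cong\<close>)
  also have "\<dots> = (\<Sum>k\<in>K. a k * conj (a k))"
  proof (intro sum.cong refl arg_cong2[of _ _ _ _ "(*)"])
    fix k assume "k \<in> K"
    then have "(\<Sum>l\<in>K. conj (a l) * ip (\<beta> k) (\<beta> l)) = (\<Sum>l\<in>K. if k = l then conj (a l) else 0)"
      using assms(3) by (intro sum.cong) auto
    then show "(\<Sum>l\<in>K. conj (a l) * ip (\<beta> k) (\<beta> l)) = conj (a k)" using assms(1) \<open>k \<in> K\<close> by simp
  qed
  also have "\<dots> = of_real (\<Sum>k\<in>K. (norm (a k))\<^sup>2)" by (simp add: mult_conj)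
  finally show ?thesis using of_real_eq_iff by blast
qed

end

section \<open>Gram-Schmidt\<close>

text \<open>Treats all spaces at once: \<open>UNIV\<close> gives \<open>ell2\<close> and
  \<open>{..<n}\<close> gives \<open>ell2n n\<close>.\<close>

definition ell2_on :: "nat set \<Rightarrow> (nat \<Rightarrow> 'a::real_normed_field) set" where
  "ell2_on J = {x \<in> ell2. \<forall>k. k \<notin> J \<longrightarrow> x k = 0}"

definition initial_segment :: "nat set \<Rightarrow> bool" where
  "initial_segment J \<longleftrightarrow> (\<forall>k l. l \<in> J \<longrightarrow> k \<le> l \<longrightarrow> k \<in> J)"

text \<open>Used to renumber the nonzero Gram-Schmidt vectors without gaps. For finite
  \<open>S\<close> only the first \<open>card S\<close> values of \<open>enumerate\<close> are
  meaningful, hence \<open>J\<close>. The bound k \<le> \<open>enumerate S k\<close> will preserve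
  triangularity.\<close>

lemma enumerate_initial_segment:
  fixes S :: "nat set"
  obtains J where "initial_segment J" "bij_betw (enumerate S) J S" "\<And>k. k \<in> J \<Longrightarrow> k \<le> enumerate S k"
proof (cases "finite S")
  case True
  show ?thesis
    by (rule that[of "{..<card S}"])
      (use True finite_bij_enumerate finite_le_enumerate in \<open>auto simp: initial_segment_def\<close>)
next
  case False
  show ?thesis
    by (rule that[of UNIV]) (use False bij_enumerate le_enumerate in \<open>auto simp: initial_segment_def\<close>)
qed

text \<open>Density is enough: truncations of a vector approximate it and are finite combinations of
  unit vectors.\<close>

lemma presentation_of_unit_vectors:
  fixes R :: "nat \<Rightarrow> nat \<Rightarrow> 'a::real_normed_field"
  assumes "\<And>i. R i \<in> ell2_on J" "\<And>j. j \<in> J \<Longrightarrow> (\<lambda>k. of_bool (k = j)) \<in> lspan R"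
  shows "presentation (ell2_on J) R"
  unfolding presentation_def
proof (intro conjI allI ballI impI)
  fix x :: "nat \<Rightarrow> 'a" and \<epsilon> :: real assume x: "x \<in> ell2_on J" and \<epsilon>: "\<epsilon> > 0"
  then obtain n where n: "ell2_norm (\<lambda>k. x k - (if k < n then x k else 0)) < \<epsilon>"
    using ell2_truncate[of x \<epsilon>] by (auto simp: ell2_on_def)
  have "(\<lambda>k. \<Sum>j\<in>{..<n} \<inter> J. x j * of_bool (k = j)) \<in> lspan R"
    by (rule lspan_sum) (use assms in auto)
  moreover have "(\<Sum>j\<in>{..<n} \<inter> J. x j * of_bool (k = j)) = (if k < n then x k else 0)" for k
  proof -
    have "(\<Sum>j\<in>{..<n} \<inter> J. x j * of_bool (k = j)) = (\<Sum>j\<in>{..<n} \<inter> J. if k = j then x j else 0)"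
      by (rule sum.cong) auto
    then show ?thesis using x by (auto simp: ell2_on_def)
  qed
  ultimately obtain m a where a: "\<And>k. (if k < n then x k else 0) = (\<Sum>i<m. a i * R i k)"
    by (auto simp: lspan_def fun_eq_iff)
  have "(\<Sum>(c, i)\<leftarrow>map (\<lambda>i. (a i, i)) [0..<m]. c * R i k) = (\<Sum>i<m. a i * R i k)" for k
    by (simp add: o_def interv_sum_list_conv_sum_set_nat atLeast0LessThan)
  then have "ell2_norm (\<lambda>k. x k - (\<Sum>(c, i)\<leftarrow>map (\<lambda>i. (a i, i)) [0..<m]. c * R i k)) < \<epsilon>"
    using n unfolding a by simp
  then show "\<exists>cs. ell2_norm (\<lambda>k. x k - (\<Sum>(c, i)\<leftarrow>cs. c * R i k)) < \<epsilon>" by blast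
qed (rule assms)

context coded_scalars begin

text \<open>If the residual vanishes, then \<open>inverse 0 = 0\<close> makes the Gram-Schmidt vector 0.\<close>

function gs :: "(nat \<Rightarrow> nat \<Rightarrow> 'a) \<Rightarrow> nat \<Rightarrow> nat \<Rightarrow> 'a" where
  "gs R i = (\<lambda>k. of_real (inverse (ell2_norm (\<lambda>k. R i k - (\<Sum>j<i. ip (R i) (gs R j) * gs R j k)))) *
     (R i k - (\<Sum>j<i. ip (R i) (gs R j) * gs R j k)))"
  by auto
termination by (relation "Wellfounded.measure (\<lambda>(R, i). i)") auto

declare gs.simps [simp del]

definition gs_residual :: "(nat \<Rightarrow> nat \<Rightarrow> 'a) \<Rightarrow> nat \<Rightarrow> nat \<Rightarrow> 'a" where
  "gs_residual R i = (\<lambda>k. R i k - (\<Sum>j<i. ip (R i) (gs R j) * gs R j k))"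

lemma gs_eq: "gs R i = (\<lambda>k. of_real (inverse (ell2_norm (gs_residual R i))) * gs_residual R i k)"
  unfolding gs_residual_def by (subst gs.simps) simp

context
  fixes R :: "nat \<Rightarrow> nat \<Rightarrow> 'a"
  assumes R: "\<And>i. R i \<in> ell2"
begin

lemma gs_residual_ell2_if: "(\<And>j. j < i \<Longrightarrow> gs R j \<in> ell2) \<Longrightarrow> gs_residual R i \<in> ell2"
  unfolding gs_residual_def by (rule ell2_diff(1)[OF R ell2_sum]) simp

lemma gs_ell2: "gs R i \<in> ell2"
proof (induction i rule: less_induct)
  case (less i)
  from ell2_scale(1)[OF gs_residual_ell2_if[OF this]] show ?case unfolding gs_eq[of R i] .
qed

lemma gs_residual_ell2: "gs_residual R i \<in> ell2"
  by (rule gs_residual_ell2_if[OF gs_ell2])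

text \<open>True also for a vanishing norm, since the residual itself is then 0. This spares a case
  distinction when \<open>R i\<close> is expanded.\<close>

lemma gs_residual_eq: "gs_residual R i k = of_real (ell2_norm (gs_residual R i)) * gs R i k"
proof (cases "ell2_norm (gs_residual R i) = 0")
  case True
  show ?thesis unfolding True of_real_0 mult_zero_left by (rule ell2_norm_eq_0[OF gs_residual_ell2 True])
next
  case False
  let ?a = "ell2_norm (gs_residual R i)"
  have "of_real (?a * inverse ?a) = (1::'a)" using False by simp
  then have one: "of_real ?a * of_real (inverse ?a) = (1::'a)" unfolding of_real_mult .
  show ?thesis
    unfolding gs_eq[of R i] by (simp only: mult.assoc[symmetric] one mult_1_left)
qed

lemma gs_zero: "ell2_norm (gs_residual R i) = 0 \<Longrightarrow> gs R i = (\<lambda>k. 0)"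
  unfolding gs_eq by simp

lemma ip_gs_self: "ip (gs R i) (gs R i) = of_bool (ell2_norm (gs_residual R i) \<noteq> 0)"
proof (cases "ell2_norm (gs_residual R i) = 0")
  case False
  have "ell2_norm (gs R i) = 1" unfolding gs_eq ell2_scale(2)[OF gs_residual_ell2]
    using False ell2_norm_nonneg[OF gs_residual_ell2] by (simp add: norm_inverse)
  then show ?thesis using False ip_self[OF gs_ell2] by simp
qed (simp add: gs_zero)

lemma ip_gs_less: "j < i \<Longrightarrow> ip (gs R i) (gs R j) = 0"
proof (induction i arbitrary: j rule: less_induct)
  case (less i)
  have ne: "ip (gs R l) (gs R j) = 0" if l: "l < i" "l \<noteq> j" for l
  proof (cases "j < l")
    case True
    then show ?thesis using less.IH l by blast
  next
    case False
    then have "ip (gs R j) (gs R l) = 0" using less.IH[of j l] less.prems l by auto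
    then show ?thesis using ip_commute[OF gs_ell2[of j] gs_ell2[of l]] by simp
  qed
  have "ip (gs_residual R i) (gs R j) = ip (R i) (gs R j) - (\<Sum>l<i. ip (R i) (gs R l) * ip (gs R l) (gs R j))"
    unfolding gs_residual_def by (subst ip_diff_left) (auto intro!: R gs_ell2 ell2_sum simp: ip_sum_left gs_ell2)
  also have "(\<Sum>l<i. ip (R i) (gs R l) * ip (gs R l) (gs R j)) =
     (\<Sum>l<i. if l = j then ip (R i) (gs R j) * ip (gs R j) (gs R j) else 0)"
    by (rule sum.cong) (use ne in auto)
  also have "\<dots> = ip (R i) (gs R j) * ip (gs R j) (gs R j)" using less.prems by simp
  \<comment> \<open>Either \<open>gs R j\<close> has norm 1, or it is 0 and both sides
    vanish.\<close>
  also have "\<dots> = ip (R i) (gs R j)"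
  proof (cases "ell2_norm (gs_residual R j) = 0")
    case True
    have "ip (R i) (\<lambda>k. 0) = 0" by (simp add: ip_def)
    then show ?thesis using gs_zero[OF True] by simp
  qed (simp add: ip_gs_self)
  finally have "ip (gs_residual R i) (gs R j) = 0" by simp
  then show ?case unfolding gs_eq[of R i] using ip_scale_left[OF gs_residual_ell2 gs_ell2] by simp
qed

lemma ip_gs: "ip (gs R i) (gs R j) = of_bool (i = j \<and> ell2_norm (gs_residual R i) \<noteq> 0)"
proof (cases i j rule: linorder_cases)
  case less
  then show ?thesis using ip_gs_less[OF less] ip_commute[OF gs_ell2[of j] gs_ell2[of i]] by simp
qed (auto simp: ip_gs_less ip_gs_self)

lemma gs_expand: "R i k = (\<Sum>j\<le>i. ip (R i) (gs R j) * gs R j k)"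
proof -
  have *: "R i k = (\<Sum>j<i. ip (R i) (gs R j) * gs R j k) + of_real (ell2_norm (gs_residual R i)) * gs R i k" for k
    unfolding gs_residual_eq[symmetric] by (simp add: gs_residual_def)
  have "ip (R i) (gs R i) = ip (\<lambda>k. (\<Sum>j<i. ip (R i) (gs R j) * gs R j k) + of_real (ell2_norm (gs_residual R i)) * gs R i k) (gs R i)"
    by (rule arg_cong[where f = "\<lambda>x. ip x (gs R i)"]) (use * in blast)
  also have "\<dots> = (\<Sum>j<i. ip (R i) (gs R j) * ip (gs R j) (gs R i)) + of_real (ell2_norm (gs_residual R i)) * ip (gs R i) (gs R i)"
    by (subst ip_add_left) (auto intro!: ell2_sum ell2_scale gs_ell2 simp: ip_sum_left ip_scale_left gs_ell2)
  \<comment> \<open>If the residual is 0, the product is 0 and so is the norm; otherwise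
    \<open>gs R i\<close> is a unit vector.\<close>
  also have "\<dots> = of_real (ell2_norm (gs_residual R i))"
    by (simp add: ip_gs)
  finally show ?thesis using *[of k] by (simp add: lessThan_Suc_atMost[symmetric])
qed

lemma gs_lspan: "gs R i \<in> lspan R"
proof (induction i rule: less_induct)
  case (less i)
  have "(\<lambda>k. R i k + (-1) * (\<Sum>j<i. ip (R i) (gs R j) * gs R j k)) \<in> lspan R"
    by (intro lspan_add lspan_scale lspan_base lspan_sum) (use less in auto)
  then have "gs_residual R i \<in> lspan R" unfolding gs_residual_def by simp
  then show ?case unfolding gs_eq by (rule lspan_scale)
qed

text \<open>The zero vectors are discarded and the rest renumbered. \<open>R i\<close> involves only
  the first i + 1 Gram-Schmidt vectors, and renumbering never raises an index, so \<open>R i\<close>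
  stays orthogonal to \<open>\<beta> k\<close> for k > i.\<close>

lemma gram_schmidt:
  obtains J \<beta> where "initial_segment J" "\<And>k. \<beta> k \<in> ell2" "\<And>k. \<beta> k \<in> lspan R"
    "\<And>k l. k \<in> J \<Longrightarrow> l \<in> J \<Longrightarrow> ip (\<beta> k) (\<beta> l) = of_bool (k = l)"
    "\<And>i x. R i x = (\<Sum>k\<in>J \<inter> {..i}. ip (R i) (\<beta> k) * \<beta> k x)"
    "\<And>i k. k \<in> J \<Longrightarrow> i < k \<Longrightarrow> ip (R i) (\<beta> k) = 0"
proof -
  define S where "S = {j. ell2_norm (gs_residual R j) \<noteq> 0}"
  obtain J where J: "initial_segment J" "bij_betw (enumerate S) J S" "\<And>k. k \<in> J \<Longrightarrow> k \<le> enumerate S k"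
    by (rule enumerate_initial_segment[of S]) blast
  define \<beta> where "\<beta> k = gs R (enumerate S k)" for k
  have orth: "ip (R i) (\<beta> k) = 0" if "enumerate S k > i" for i k
  proof -
    have "R i = (\<lambda>x. \<Sum>j\<le>i. ip (R i) (gs R j) * gs R j x)" using gs_expand by blast
    from arg_cong[OF this, of "\<lambda>x. ip x (\<beta> k)"]
    have "ip (R i) (\<beta> k) = ip (\<lambda>x. \<Sum>j\<le>i. ip (R i) (gs R j) * gs R j x) (\<beta> k)" .
    also have "\<dots> = (\<Sum>j\<le>i. ip (R i) (gs R j) * ip (gs R j) (\<beta> k))"
      by (rule ip_sum_left) (auto simp: gs_ell2 \<beta>_def)
    also have "\<dots> = 0" using that by (intro sum.neutral) (auto simp: \<beta>_def ip_gs)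
    finally show ?thesis .
  qed
  show ?thesis
  proof (rule that[OF J(1), of \<beta>])
    show "\<beta> k \<in> ell2" "\<beta> k \<in> lspan R" for k by (auto simp: \<beta>_def gs_ell2 gs_lspan)
    show "ip (\<beta> k) (\<beta> l) = of_bool (k = l)" if "k \<in> J" "l \<in> J" for k l
    proof -
      have "enumerate S k \<in> S" using J(2) that by (auto simp: bij_betw_def)
      moreover have "enumerate S k = enumerate S l \<longleftrightarrow> k = l"
        using J(2) that by (auto simp: bij_betw_def inj_on_def)
      ultimately show ?thesis by (simp add: \<beta>_def ip_gs S_def)
    qed
    show "ip (R i) (\<beta> k) = 0" if "k \<in> J" "i < k" for i k
      by (rule orth) (use J(3)[OF that(1)] that(2) in simp)
    show "R i x = (\<Sum>k\<in>J \<inter> {..i}. ip (R i) (\<beta> k) * \<beta> k x)" for i x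
    proof -
      define K where "K = {k \<in> J. enumerate S k \<le> i}"
      have inj: "inj_on (enumerate S) K" using J(2) by (auto simp: K_def bij_betw_def inj_on_def)
      have im: "enumerate S ` K = S \<inter> {..i}" using J(2) by (force simp: K_def bij_betw_def)
      have "R i x = (\<Sum>j\<le>i. ip (R i) (gs R j) * gs R j x)" by (rule gs_expand)
      also have "\<dots> = (\<Sum>j\<in>S \<inter> {..i}. ip (R i) (gs R j) * gs R j x)"
        by (rule sum.mono_neutral_right) (auto simp: S_def gs_zero)
      also have "\<dots> = (\<Sum>k\<in>K. ip (R i) (\<beta> k) * \<beta> k x)"
        unfolding im[symmetric] using sum.reindex[OF inj] by (simp add: \<beta>_def o_def)
      also have "\<dots> = (\<Sum>k\<in>J \<inter> {..i}. ip (R i) (\<beta> k) * \<beta> k x)"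
        by (rule sum.mono_neutral_left) (use orth J(3) in \<open>force simp: K_def not_le\<close>)+
      finally show ?thesis .
    qed
  qed
qed

text \<open>\<open>R' i\<close> is the coordinate sequence of \<open>R i\<close> in the orthonormal
  system \<open>\<beta>\<close>, so Parseval gives equal norms for all finite combinations. Unit
  vectors lie in the span of \<open>R'\<close> because each \<open>\<beta> j\<close> lies in that of
  \<open>R\<close>. \<open>J\<close> measures the dimension of the span of \<open>R\<close>, whence
  the last clause.\<close>

lemma isometric_triangular_copy:
  obtains R' J where "initial_segment J" "triangular R'" "\<And>i k. k \<notin> J \<Longrightarrow> R' i k = 0"
    "\<And>n c s. ell2_norm (\<lambda>x. \<Sum>y<n. c y * R' (s y) x) = ell2_norm (\<lambda>x. \<Sum>y<(n::nat). c y * R (s y) x)"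
    "\<And>j. j \<in> J \<Longrightarrow> (\<lambda>k. of_bool (k = j)) \<in> lspan R'"
    "\<And>n. (\<And>i k. k \<ge> n \<Longrightarrow> R i k = 0) \<Longrightarrow> J \<subseteq> {..<n}"
proof -
  obtain J \<beta> where J: "initial_segment J" and \<beta>: "\<And>k. \<beta> k \<in> ell2" "\<And>k. \<beta> k \<in> lspan R"
    and on: "\<And>k l. k \<in> J \<Longrightarrow> l \<in> J \<Longrightarrow> ip (\<beta> k) (\<beta> l) = of_bool (k = l)"
    and ex: "\<And>i x. R i x = (\<Sum>k\<in>J \<inter> {..i}. ip (R i) (\<beta> k) * \<beta> k x)"
    and tri: "\<And>i k. k \<in> J \<Longrightarrow> i < k \<Longrightarrow> ip (R i) (\<beta> k) = 0"
    using gram_schmidt by blast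
  define R' where "R' i k = (if k \<in> J then ip (R i) (\<beta> k) else 0)" for i k
  have tri': "R' i k = 0" if "i < k" for i k using tri that by (simp add: R'_def)
  show ?thesis
  proof (rule that[OF J, of R'])
    show "triangular R'" using tri' by (simp add: triangular_def)
    show "R' i k = 0" if "k \<notin> J" for i k using that by (simp add: R'_def)
    show "ell2_norm (\<lambda>x. \<Sum>y<n. c y * R' (s y) x) = ell2_norm (\<lambda>x. \<Sum>y<n. c y * R (s y) x)" for n :: nat and c s
    proof -
      \<comment> \<open>Bounds all row indices in the combination, so that every row expands over
        the same finite set of basis vectors.\<close>
      define N where "N = Max (insert 0 (s ` {..<n}))"
      have N: "s y \<le> N" if "y < n" for y unfolding N_def using that by (intro Max_ge) auto
      define K where "K = J \<inter> {..N}"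
      have K: "finite K" by (simp add: K_def)
      define a where "a k = (\<Sum>y<n. c y * R' (s y) k)" for k
      have "R (s y) x = (\<Sum>k\<in>K. R' (s y) k * \<beta> k x)" if "y < n" for y x
        unfolding ex[of "s y" x]
        using N[OF that] tri[of _ "s y"]
        by (intro sum.mono_neutral_cong_left) (force simp: K_def R'_def not_le)+
      then have "(\<Sum>y<n. c y * R (s y) x) = (\<Sum>y<n. \<Sum>k\<in>K. c y * R' (s y) k * \<beta> k x)" for x
        by (simp add: sum_distrib_left mult.assoc)
      also have "\<dots> x = (\<Sum>k\<in>K. a k * \<beta> k x)" for x
        unfolding a_def by (subst sum.swap) (simp add: sum_distrib_right)
      finally have eq: "(\<lambda>x. \<Sum>y<n. c y * R (s y) x) = (\<lambda>x. \<Sum>k\<in>K. a k * \<beta> k x)" by blast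
      have a0: "a k = 0" if "k \<ge> Suc N" for k unfolding a_def
        using that by (intro sum.neutral) (auto simp: tri' dest!: N)
      have "(ell2_norm (\<lambda>x. \<Sum>k\<in>K. a k * \<beta> k x))\<^sup>2 = (\<Sum>k\<in>K. (norm (a k))\<^sup>2)"
        by (rule ell2_norm_orthonormal_sum[OF K]) (auto simp: \<beta> on K_def)
      also have "\<dots> = (\<Sum>k<Suc N. (norm (a k))\<^sup>2)"
      proof (rule sum.mono_neutral_left)
        have "a k = 0" if "k \<notin> J" for k using that by (simp add: a_def R'_def)
        then show "\<forall>k\<in>{..<Suc N} - K. (norm (a k))\<^sup>2 = 0" by (auto simp: K_def)
      qed (auto simp: K_def)
      also have "\<dots> = (ell2_norm a)\<^sup>2"
        using ell2_norm_finite[OF a0] by (simp add: sum_nonneg del: sum.lessThan_Suc)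
      finally have "ell2_norm (\<lambda>x. \<Sum>k\<in>K. a k * \<beta> k x) = ell2_norm a"
        using ell2_norm_nonneg[OF ell2_sum[of K \<beta> a]] ell2_norm_nonneg[OF ell2_finite_support[OF a0]] \<beta>
        by (simp add: power2_eq_iff_nonneg)
      then show ?thesis unfolding eq a_def by simp
    qed
    show "(\<lambda>k. of_bool (k = j)) \<in> lspan R'" if j: "j \<in> J" for j
    proof -
      obtain n a where a: "\<beta> j = (\<lambda>x. \<Sum>i<n. a i * R i x)" using \<beta>(2)[of j] by (auto simp: lspan_def)
      have "of_bool (k = j) = (\<Sum>i<n. a i * R' i k)" for k
      proof (cases "k \<in> J")
        case True
        have "of_bool (k = j) = ip (\<beta> j) (\<beta> k)" using on[OF j True] by (auto simp: of_bool_def)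
        also have "\<dots> = (\<Sum>i<n. a i * ip (R i) (\<beta> k))"
          using ip_sum_left[of "{..<n}" R "\<beta> k" a] R \<beta> unfolding a by simp
        finally show ?thesis using True by (simp add: R'_def)
      qed (use j in \<open>auto simp: R'_def\<close>)
      then have "(\<lambda>k. of_bool (k = j)) = (\<lambda>k. \<Sum>i<n. a i * R' i k)" by blast
      then show ?thesis unfolding lspan_def mem_Collect_eq by (intro exI)
    qed
    show "J \<subseteq> {..<n}" if supp: "\<And>i k. k \<ge> n \<Longrightarrow> R i k = 0" for n
    proof (rule ccontr)
      assume "\<not> J \<subseteq> {..<n}"
      then obtain l where "l \<in> J" "n \<le> l" by (meson lessThan_iff not_less subsetI)
      then have nJ: "{..n} \<subseteq> J" using J unfolding initial_segment_def by force
      \<comment> \<open>n + 1 vectors with only n coordinates that can be nonzero are dependent,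
        which contradicts Parseval.\<close>
      have fin: "finite {..<n}" "finite {..n}" "card {..<n} < card {..n}" by simp_all
      from exists_nontrivial_solution[OF fin, of \<beta>] obtain c where
        c: "\<exists>j\<in>{..n}. c j \<noteq> 0" "\<forall>k\<in>{..<n}. (\<Sum>j\<le>n. c j * \<beta> j k) = 0" by blast
      have \<beta>0: "\<beta> j k = 0" if k: "k \<ge> n" for j k
      proof -
        obtain m a where "\<beta> j = (\<lambda>x. \<Sum>i<m. a i * R i x)" using \<beta>(2)[of j] by (auto simp: lspan_def)
        then show ?thesis using supp[OF k] by (metis (no_types, lifting) mult_zero_right sum.neutral)
      qed
      have "(\<Sum>j\<le>n. c j * \<beta> j k) = 0" for k
        using c(2) \<beta>0[of k] by (cases "k < n") simp_all
      moreover have "(ell2_norm (\<lambda>k. \<Sum>j\<le>n. c j * \<beta> j k))\<^sup>2 = (\<Sum>j\<le>n. (norm (c j))\<^sup>2)"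
        by (rule ell2_norm_orthonormal_sum) (simp_all add: \<beta> on subsetD[OF nJ])
      ultimately have "(\<Sum>j\<le>n. (norm (c j))\<^sup>2) = 0" by (simp add: ell2_norm_def)
      then show False using c(1) by (simp add: sum_nonneg_eq_0_iff)
    qed
  qed
qed

end

end

section \<open>Compactness\<close>

lemma tendsto_norm_bound:
  fixes l :: "'b::real_normed_vector"
  assumes "\<forall>\<^sub>F x in F. norm (g x - l) \<le> h x" "(h \<longlongrightarrow> 0) F"
  shows "(g \<longlongrightarrow> l) F"
  using Lim_null_comparison[OF assms] by (rule LIM_zero_cancel)

section \<open>Families of reals given by their rational intervals\<close>

definition ivl_lo :: "nat \<Rightarrow> real" where "ivl_lo x = rat_dec (pfst (psnd x))"
definition ivl_hi :: "nat \<Rightarrow> real" where "ivl_hi x = rat_dec (psnd (psnd x))"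

text \<open>A diagram depends on \<open>R\<close> only through the norms of the rational vectors.
  Hence isometric copies share it, and describing a family of reals can be separated from the
  geometry.\<close>

definition cut_codes :: "(nat \<Rightarrow> real) \<Rightarrow> nat set" where
  "cut_codes N = {x. ivl_lo x < N (pfst x) \<and> N (pfst x) < ivl_hi x}"

lemma diagram_eq_cut_codes: "diagram dec R = cut_codes (\<lambda>m. ell2_norm (rat_vec dec R m))"
proof -
  have "x \<in> diagram dec R \<longleftrightarrow> ell2_norm (rat_vec dec R (pfst x)) \<in> rat_interval (psnd x)" for x
    unfolding diagram_def mem_Collect_eq by (metis pfst_prod_encode psnd_prod_encode prod_encode_pfst_psnd)
  then show ?thesis by (auto simp: cut_codes_def in_rat_interval ivl_lo_def ivl_hi_def)
qed

lemma cut_codes_exists: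
  assumes "a < N m" "N m < b"
  shows "\<exists>x \<in> cut_codes N. pfst x = m \<and> a < ivl_lo x \<and> ivl_hi x < b"
proof -
  obtain c d where "a < rat_dec c" "rat_dec c < N m" "N m < rat_dec d" "rat_dec d < b"
    using rat_dec_between[OF assms(1)] rat_dec_between[OF assms(2)] by blast
  then show ?thesis
    by (intro bexI[of _ "prod_encode (m, prod_encode (c, d))"]) (auto simp: cut_codes_def ivl_lo_def ivl_hi_def)
qed

lemma infinite_cut_codes: "infinite (cut_codes N)"
proof
  assume "finite (cut_codes N)"
  then have "finite (pfst ` cut_codes N)" by simp
  moreover have "m \<in> pfst ` cut_codes N" for m
    using cut_codes_exists[of "N m - 1" N m "N m + 1"] by auto
  then have "pfst ` cut_codes N = UNIV" by blast
  ultimately show False by simp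
qed

text \<open>This and the next two conditions describe the list of all rational open intervals around
  each member of a family of reals. They do not say that the intervals for one index have a common
  point; \<open>approximable\<close> will supply such points.\<close>

definition shrinking :: "(nat \<Rightarrow> nat) \<Rightarrow> bool" where
  "shrinking f \<longleftrightarrow> (\<forall>m q. \<exists>j. pfst (f j) = m \<and> ivl_hi (f j) < ivl_lo (f j) + 1 / real (Suc q))"

definition inward :: "(nat \<Rightarrow> nat) \<Rightarrow> bool" where
  "inward f \<longleftrightarrow> (\<forall>j. \<exists>i. pfst (f i) = pfst (f j) \<and> ivl_lo (f j) < ivl_lo (f i) \<and> ivl_hi (f i) < ivl_hi (f j))"

definition outward :: "(nat \<Rightarrow> nat) \<Rightarrow> bool" where
  "outward f \<longleftrightarrow> (\<forall>j n. rat_dec (pfst n) < ivl_lo (f j) \<and> ivl_hi (f j) < rat_dec (psnd n) \<longrightarrow>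
     (\<exists>i. f i = prod_encode (pfst (f j), n)))"

text \<open>Only weak bounds are assumed because a limit argument provides no more.
  \<open>inward\<close> restores strictness: the weak bounds of an interval strictly inside are
  strict bounds for the outer one.\<close>

lemma range_eq_cut_codes_if:
  assumes "shrinking f" "inward f" "outward f"
    and N: "\<And>j. ivl_lo (f j) \<le> N (pfst (f j))" "\<And>j. N (pfst (f j)) \<le> ivl_hi (f j)"
  shows "range f = cut_codes N"
proof
  show "range f \<subseteq> cut_codes N"
  proof
    fix x assume "x \<in> range f"
    then obtain j where x: "x = f j" by blast
    obtain i where "pfst (f i) = pfst x" "ivl_lo x < ivl_lo (f i)" "ivl_hi (f i) < ivl_hi x"
      using assms(2) unfolding inward_def x by blast
    then show "x \<in> cut_codes N" using N[of i] by (simp add: cut_codes_def)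
  qed
  show "cut_codes N \<subseteq> range f"
  proof
    fix x assume x: "x \<in> cut_codes N"
    \<comment> \<open>An interval shorter than the distance from the point to both end points of
      \<open>x\<close> lies strictly inside \<open>x\<close>.\<close>
    define \<delta> where "\<delta> = min (N (pfst x) - ivl_lo x) (ivl_hi x - N (pfst x))"
    have "\<delta> > 0" using x by (simp add: \<delta>_def cut_codes_def)
    then obtain q where q: "1 / real (Suc q) < \<delta>" using nat_approx_posE by auto
    obtain j where j: "pfst (f j) = pfst x" "ivl_hi (f j) < ivl_lo (f j) + 1 / real (Suc q)"
      using assms(1) unfolding shrinking_def by blast
    have "ivl_lo x < ivl_lo (f j)" "ivl_hi (f j) < ivl_hi x"
      using N[of j] j q by (auto simp: \<delta>_def)
    then have "\<exists>i. f i = prod_encode (pfst (f j), psnd x)"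
      using assms(3) unfolding outward_def ivl_lo_def ivl_hi_def by blast
    then show "x \<in> range f" using j(1) by (metis prod_encode_pfst_psnd rangeI)
  qed
qed

lemma range_eq_cut_codesD:
  assumes "range f = cut_codes N"
  shows "shrinking f" "inward f" "outward f"
proof -
  have ex: "\<exists>j. pfst (f j) = m \<and> a < ivl_lo (f j) \<and> ivl_hi (f j) < b" if ab: "a < N m" "N m < b" for a b m
  proof -
    obtain x where "x \<in> cut_codes N" "pfst x = m" "a < ivl_lo x" "ivl_hi x < b"
      using cut_codes_exists[of a N m b] ab by blast
    then show ?thesis using assms by (metis imageE)
  qed
  have fN: "ivl_lo (f j) < N (pfst (f j))" "N (pfst (f j)) < ivl_hi (f j)" for j
    using rangeI[of f j] unfolding assms cut_codes_def by auto
  show "shrinking f" unfolding shrinking_def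
  proof (intro allI)
    fix m q
    define \<delta> where "\<delta> = 1 / real (Suc q) / 2"
    have "\<delta> > 0" by (simp add: \<delta>_def)
    then obtain j where "pfst (f j) = m" "N m - \<delta> < ivl_lo (f j)" "ivl_hi (f j) < N m + \<delta>"
      using ex[of "N m - \<delta>" m "N m + \<delta>"] by auto
    moreover have "\<delta> + \<delta> = 1 / real (Suc q)" unfolding \<delta>_def by (simp add: field_simps)
    ultimately show "\<exists>j. pfst (f j) = m \<and> ivl_hi (f j) < ivl_lo (f j) + 1 / real (Suc q)"
      by (intro exI[of _ j]) linarith
  qed
  show "inward f" unfolding inward_def using ex[OF fN] by blast
  show "outward f" unfolding outward_def
  proof (intro allI impI)
    fix j n assume "rat_dec (pfst n) < ivl_lo (f j) \<and> ivl_hi (f j) < rat_dec (psnd n)"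
    then have "prod_encode (pfst (f j), n) \<in> cut_codes N"
      using fN[of j] by (auto simp: cut_codes_def ivl_lo_def ivl_hi_def)
    then show "\<exists>i. f i = prod_encode (pfst (f j), n)" using assms by (metis imageE)
  qed
qed

text \<open>Concatenation is formal addition, so norms of sums of rational vectors also occur in the
  diagram.\<close>

definition code_append :: "nat \<Rightarrow> nat \<Rightarrow> nat" where
  "code_append u v = list_encode (list_decode u @ list_decode v)"

lemma rat_vec_code_append: "rat_vec dec R (code_append u v) k = rat_vec dec R u k + rat_vec dec R v k"
  by (simp add: rat_vec_def code_append_def)

lemma computable_code_append:
  assumes "computable F" "computable G" shows "computable (\<lambda>x. code_append (F x) (G x))"
proof -
  have "code_append u v = list_encode (map (\<lambda>i. if i < code_length u then code_nth u i else code_nth v (i - code_length u))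
     [0..<code_length u + code_length v])" for u v
    unfolding code_append_def
    by (intro arg_cong[of _ _ list_encode] nth_equalityI) (auto simp: code_length_def code_nth_def nth_append)
  moreover have "computable (\<lambda>x. list_encode (map (\<lambda>i. if i < code_length (F x) then code_nth (F x) i
      else code_nth (G x) (i - code_length (F x))) [0..<code_length (F x) + code_length (G x)]))"
    by (intro computable_tabulate computable_intros computable_code_nth computable_code_length
        computable_comp[OF assms(1)] computable_comp[OF assms(2)] assms)
  ultimately show ?thesis by simp
qed

text \<open>For triangular arrays the norm of the m-th rational vector is the root of a sum whose
  length depends on m alone, so entrywise convergence suffices.\<close>

lemma tendsto_ell2_norm_rat_vec:
  assumes "\<And>q. triangular (T q)" "triangular R" "\<And>i k. (\<lambda>q. T q i k) \<longlonglongrightarrow> R i k"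
  shows "(\<lambda>q. ell2_norm (rat_vec dec (T q) m)) \<longlonglongrightarrow> ell2_norm (rat_vec dec R m)"
  unfolding ell2_norm_rat_vec_triangular[OF assms(1)] ell2_norm_rat_vec_triangular[OF assms(2)] rat_vec_eq_sum
  by (intro tendsto_intros assms(3))

lemma rat_vec_ell2: "(\<And>i. R i \<in> ell2) \<Longrightarrow> rat_vec dec R m \<in> ell2"
  using ell2_sum[of "{..<code_length m}" "\<lambda>y. R (psnd (code_nth m y))" "\<lambda>y. dec (pfst (code_nth m y))"]
  by (simp add: rat_vec_eq_sum[abs_def])

lemma triangular_ell2: "triangular R \<Longrightarrow> R i \<in> ell2"
  by (rule ell2_finite_support[of "Suc i"]) (auto simp: triangular_def)

lemma rat_vec_list_encode_Cons:
  "rat_vec dec R (list_encode (prod_encode (c, i) # list_decode m)) k = dec c * R i k + rat_vec dec R m k"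
  by (simp add: rat_vec_def)

lemma convergent_diagonal_subsequence:
  fixes X :: "nat \<Rightarrow> nat \<Rightarrow> 'a::{heine_borel, real_normed_vector}"
  assumes "\<And>p. Bseq (X p)"
  shows "\<exists>d. strict_mono d \<and> (\<forall>p. convergent (\<lambda>n. X p (d n)))"
proof -
  let ?P = "\<lambda>p s. convergent (\<lambda>n. X p (s n))"
  interpret subseqs ?P
  proof
    fix p and s :: "nat \<Rightarrow> nat" assume "strict_mono s"
    have "bounded (range (X p \<circ> s))"
      using assms[of p] unfolding Bseq_eq_bounded by (rule bounded_subset) auto
    then obtain l r where "strict_mono r" "((X p \<circ> s) \<circ> r) \<longlonglongrightarrow> l"
      using bounded_imp_convergent_subsequence by blast
    then show "\<exists>r'. strict_mono r' \<and> convergent (\<lambda>n. X p ((s \<circ> r') n))"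
      by (auto simp: convergent_def o_def)
  qed
  have "?P p (diagseq \<circ> (+) (Suc p))" for p
  proof (rule diagseq_holds)
    fix r s :: "nat \<Rightarrow> nat" and n assume "strict_mono r" "?P n s"
    then show "?P n (s \<circ> r)" using convergent_subseq_convergent[of "\<lambda>k. X n (s k)" r] by (simp add: o_def)
  qed
  \<comment> \<open>Only from index p + 1 on is the diagonal sequence known to be a subsequence of
    the p-th one; the shift is removed afterwards.\<close>
  then have "convergent (\<lambda>n. X p (diagseq (n + Suc p)))" for p
    unfolding o_def by (simp only: add.commute)
  then have "convergent (\<lambda>n. X p (diagseq n))" for p
    using convergent_ignore_initial_segment[of "\<lambda>n. X p (diagseq n)" "Suc p"] by blast
  then show ?thesis using subseq_diagseq by blast
qed

section \<open>Rational triangular arrays and their limits\<close>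

context coded_scalars begin

text \<open>\<open>w\<close> codes a list of coded rows. Missing entries read as 0, the code of the
  scalar 0, so every number describes a legitimate array, triangular with columns in
  \<open>J\<close>.\<close>

definition entry_code :: "nat set \<Rightarrow> nat \<Rightarrow> nat \<Rightarrow> nat \<Rightarrow> nat" where
  "entry_code J w i k = (if k \<le> i \<and> k \<in> J then code_nth (code_nth w i) k else 0)"

definition approximant :: "nat set \<Rightarrow> nat \<Rightarrow> nat \<Rightarrow> nat \<Rightarrow> 'a" where
  "approximant J w i k = dec (entry_code J w i k)"

lemma triangular_approximant: "triangular (approximant J w)"
  by (auto simp: triangular_def approximant_def entry_code_def dec_0)

definition approximable :: "nat set \<Rightarrow> (nat \<Rightarrow> nat) \<Rightarrow> bool" where
  "approximable J f \<longleftrightarrow> (\<forall>M. \<exists>w. \<forall>j<M. ivl_lo (f j) < ell2_norm (rat_vec dec (approximant J w) (pfst (f j))) \<and>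
      ell2_norm (rat_vec dec (approximant J w) (pfst (f j))) < ivl_hi (f j))"

context
  fixes J :: "nat set"
  assumes J: "initial_segment J"
begin

text \<open>Density of the span is not claimed: the limit may have smaller dimension than the
  approximants.\<close>

lemma approximable_limit:
  assumes "approximable J f" "shrinking f"
  obtains R where "triangular R" "\<And>i k. k \<notin> J \<Longrightarrow> R i k = 0"
    "\<And>j. ivl_lo (f j) \<le> ell2_norm (rat_vec dec R (pfst (f j)))"
    "\<And>j. ell2_norm (rat_vec dec R (pfst (f j))) \<le> ivl_hi (f j)"
proof -
  obtain w where w: "\<And>M j. j < M \<Longrightarrow> ivl_lo (f j) < ell2_norm (rat_vec dec (approximant J (w M)) (pfst (f j)))"
    "\<And>M j. j < M \<Longrightarrow> ell2_norm (rat_vec dec (approximant J (w M)) (pfst (f j))) < ivl_hi (f j)"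
    using assms(1) unfolding approximable_def by metis
  define T where "T M = approximant J (w M)" for M
  have T: "triangular (T M)" for M unfolding T_def by (rule triangular_approximant)
  have B: "Bseq (\<lambda>M. T M i k)" for i k
  proof -
    \<comment> \<open>The rational vector 1 times \<open>R i\<close> has a listed interval; its
      upper end point bounds row i of all approximants that satisfy constraint j.\<close>
    obtain j where j: "pfst (f j) = list_encode [prod_encode (cone, i)]"
      using assms(2) unfolding shrinking_def by blast
    have "norm (T (M + Suc j) i k) \<le> ivl_hi (f j)" for M
    proof -
      have "rat_vec dec (T (M + Suc j)) (list_encode [prod_encode (cone, i)]) = T (M + Suc j) i"
        by (auto simp: rat_vec_def dec_cone)
      then have "ell2_norm (T (M + Suc j) i) < ivl_hi (f j)"
        using w(2)[of j "M + Suc j"] unfolding j T_def by simp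
      then show ?thesis using norm_le_ell2_norm[OF triangular_ell2[OF T], of "M + Suc j" i k] by linarith
    qed
    then have "Bseq (\<lambda>M. T (M + Suc j) i k)" by (rule BseqI')
    then show ?thesis by (rule Bseq_offset)
  qed
  obtain d where d: "strict_mono d" "\<And>p. convergent (\<lambda>n. T (d n) (pfst p) (psnd p))"
    using convergent_diagonal_subsequence[of "\<lambda>p M. T M (pfst p) (psnd p)"] B by blast
  define R where "R i k = lim (\<lambda>n. T (d n) i k)" for i k
  have R: "(\<lambda>n. T (d n) i k) \<longlonglongrightarrow> R i k" for i k
    using d(2)[of "prod_encode (i, k)"] unfolding R_def by (simp add: convergent_LIMSEQ_iff)
  have zero: "R i k = 0" if "\<And>M. T M i k = 0" for i k
    unfolding R_def using that by simp
  have triR: "triangular R" using T zero unfolding triangular_def by blast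
  have lim: "(\<lambda>n. ell2_norm (rat_vec dec (T (d n)) m)) \<longlonglongrightarrow> ell2_norm (rat_vec dec R m)" for m
    by (rule tendsto_ell2_norm_rat_vec[OF T triR R])
  \<comment> \<open>Every constraint is met from some stage of the subsequence on, hence weakly in
    the limit.\<close>
  have dn: "j < d n" if "Suc j \<le> n" for j n using strict_mono_imp_increasing[OF d(1), of n] that by simp
  show ?thesis
  proof (rule that[OF triR])
    show "R i k = 0" if "k \<notin> J" for i k
      by (rule zero) (use that in \<open>simp add: T_def approximant_def entry_code_def dec_0\<close>)
    show "ivl_lo (f j) \<le> ell2_norm (rat_vec dec R (pfst (f j)))" for j
      by (rule LIMSEQ_le_const[OF lim], rule exI[of _ "Suc j"]) (auto simp: T_def intro!: less_imp_le w(1) dn)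
    show "ell2_norm (rat_vec dec R (pfst (f j))) \<le> ivl_hi (f j)" for j
      by (rule LIMSEQ_le_const2[OF lim], rule exI[of _ "Suc j"]) (auto simp: T_def intro!: less_imp_le w(2) dn)
  qed
qed

text \<open>If n is outside the initial segment \<open>J\<close>, all rows vanish from n on, and the
  dimension bound of the triangular copy keeps n out of \<open>J'\<close>.\<close>

lemma isometric_copy_in_segment:
  assumes "\<And>i. R i \<in> ell2" "\<And>i k. k \<notin> J \<Longrightarrow> R i k = 0"
  obtains R' J' where "initial_segment J'" "J' \<subseteq> J" "triangular R'" "\<And>i k. k \<notin> J' \<Longrightarrow> R' i k = 0"
    "\<And>m. ell2_norm (rat_vec dec R' m) = ell2_norm (rat_vec dec R m)"
    "\<And>j. j \<in> J' \<Longrightarrow> (\<lambda>k. of_bool (k = j)) \<in> lspan R'"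
proof (rule isometric_triangular_copy[of R, OF assms(1)])
  fix R' :: "nat \<Rightarrow> nat \<Rightarrow> 'a" and J' :: "nat set"
  assume R': "initial_segment J'" "triangular R'" "\<And>i k. k \<notin> J' \<Longrightarrow> R' i k = 0"
    and norm: "\<And>n c s. ell2_norm (\<lambda>x. \<Sum>y<n. c y * R' (s y) x) = ell2_norm (\<lambda>x. \<Sum>y<(n::nat). c y * R (s y) x)"
    and sp: "\<And>j. j \<in> J' \<Longrightarrow> (\<lambda>k. of_bool (k = j)) \<in> lspan R'"
    and sub: "\<And>n. (\<And>i k. k \<ge> n \<Longrightarrow> R i k = 0) \<Longrightarrow> J' \<subseteq> {..<n}"
  have "J' \<subseteq> J"
  proof
    fix n assume "n \<in> J'"
    show "n \<in> J"
    proof (rule ccontr)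
      assume "n \<notin> J"
      then have "k \<notin> J" if "k \<ge> n" for k using J that unfolding initial_segment_def by blast
      then have "J' \<subseteq> {..<n}" using sub assms(2) by blast
      then show False using \<open>n \<in> J'\<close> by auto
    qed
  qed
  moreover have "ell2_norm (rat_vec dec R' m) = ell2_norm (rat_vec dec R m)" for m
    using norm by (simp add: rat_vec_eq_sum[abs_def])
  ultimately show ?thesis using that[OF R'(1) _ R'(2,3) _ sp] by blast
qed

text \<open>The entries of the triangular copy are approximated by coded scalars. The first M
  constraints are finitely many strict inequalities, so they hold for all good enough
  approximations.\<close>

lemma presentation_approximable:
  assumes "presentation (ell2_on J) R" "range f = diagram dec R"
  shows "approximable J f"
proof -
  have R: "R i \<in> ell2" "k \<notin> J \<Longrightarrow> R i k = 0" for i k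
    using assms(1) by (auto simp: presentation_def ell2_on_def)
  obtain R' J' where R': "J' \<subseteq> J" "triangular R'" "\<And>i k. k \<notin> J' \<Longrightarrow> R' i k = 0"
    and norm: "\<And>m. ell2_norm (rat_vec dec R' m) = ell2_norm (rat_vec dec R m)"
    by (rule isometric_copy_in_segment[of R, OF R]) blast+
  define c where "c q i k = (SOME c. norm (dec c - R' i k) < 1 / real (Suc q))" for q i k
  have c: "norm (dec (c q i k) - R' i k) < 1 / real (Suc q)" for q i k
    unfolding c_def by (rule someI_ex[OF dec_dense]) simp
  define w where "w q = list_encode (map (\<lambda>i. list_encode (map (c q i) [0..<Suc q])) [0..<Suc q])" for q
  have w: "norm (approximant J (w q) i k - R' i k) \<le> 1 / real (Suc q)" if "i \<le> q" "k \<le> q" for q i k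
  proof (cases "k \<le> i \<and> k \<in> J")
    case True
    then have "entry_code J (w q) i k = c q i k"
      using that by (simp add: entry_code_def w_def code_nth_def nth_append del: upt_Suc)
    then show ?thesis using c[of q i k] by (simp add: approximant_def)
  next
    case False
    \<comment> \<open>Where \<open>entry_code\<close> forces 0, the copy has the entry 0 as well, so
      the approximation is exact there.\<close>
    then have "R' i k = 0" using R'(1,3) R'(2)[unfolded triangular_def] by (meson not_le subsetD)
    then show ?thesis using False by (auto simp: approximant_def entry_code_def dec_0)
  qed
  have "(\<lambda>q. approximant J (w q) i k) \<longlonglongrightarrow> R' i k" for i k
  proof (rule tendsto_norm_bound)
    show "\<forall>\<^sub>F q in sequentially. norm (approximant J (w q) i k - R' i k) \<le> 1 / real (Suc q)"
      using eventually_ge_at_top[of "max i k"] by eventually_elim (rule w, auto)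
    show "(\<lambda>q. 1 / real (Suc q)) \<longlonglongrightarrow> 0"
      using LIMSEQ_inverse_real_of_nat by (simp add: inverse_eq_divide)
  qed
  from tendsto_ell2_norm_rat_vec[OF triangular_approximant R'(2) this, of dec]
  have lim: "(\<lambda>q. ell2_norm (rat_vec dec (approximant J (w q)) m)) \<longlonglongrightarrow> ell2_norm (rat_vec dec R m)" for m
    unfolding norm .
  show ?thesis unfolding approximable_def
  proof
    fix M
    have "\<forall>\<^sub>F q in sequentially. \<forall>j\<in>{..<M}. ivl_lo (f j) < ell2_norm (rat_vec dec (approximant J (w q)) (pfst (f j))) \<and>
      ell2_norm (rat_vec dec (approximant J (w q)) (pfst (f j))) < ivl_hi (f j)"
    proof (intro eventually_ball_finite ballI eventually_conj)
      fix j
      have "f j \<in> cut_codes (\<lambda>m. ell2_norm (rat_vec dec R m))"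
        using assms(2) diagram_eq_cut_codes by (metis rangeI)
      then have *: "ivl_lo (f j) < ell2_norm (rat_vec dec R (pfst (f j)))" "ell2_norm (rat_vec dec R (pfst (f j))) < ivl_hi (f j)"
        by (auto simp: cut_codes_def)
      show "\<forall>\<^sub>F q in sequentially. ivl_lo (f j) < ell2_norm (rat_vec dec (approximant J (w q)) (pfst (f j)))"
        by (rule order_tendstoD(1)[OF lim *(1)])
      show "\<forall>\<^sub>F q in sequentially. ell2_norm (rat_vec dec (approximant J (w q)) (pfst (f j))) < ivl_hi (f j)"
        by (rule order_tendstoD(2)[OF lim *(2)])
    qed simp
    then show "\<exists>w. \<forall>j<M. ivl_lo (f j) < ell2_norm (rat_vec dec (approximant J w) (pfst (f j))) \<and>
      ell2_norm (rat_vec dec (approximant J w) (pfst (f j))) < ivl_hi (f j)"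
      by (auto simp: eventually_sequentially)
  qed
qed

end

end

section \<open>Dimension\<close>

text \<open>Continuity at 0 leaves room for replacing norms by end points of short intervals; t
  below both sides keeps the lower bounds positive, so that squares can be compared.\<close>

lemma obtuse_perturbation:
  fixes \<alpha> \<beta> \<gamma> :: real
  assumes "\<alpha> > 0" "\<beta> > 0" "\<gamma>\<^sup>2 < \<alpha>\<^sup>2 + \<beta>\<^sup>2"
  shows "\<exists>t>0. t < \<alpha> \<and> t < \<beta> \<and> (\<gamma> + t)\<^sup>2 < (\<alpha> - t)\<^sup>2 + (\<beta> - t)\<^sup>2"
proof -
  have lim: "((\<lambda>t. (\<alpha> - t)\<^sup>2 + (\<beta> - t)\<^sup>2 - (\<gamma> + t)\<^sup>2) \<longlongrightarrow> (\<alpha> - 0)\<^sup>2 + (\<beta> - 0)\<^sup>2 - (\<gamma> + 0)\<^sup>2) (at_right 0)"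
    by (intro tendsto_intros)
  have pos: "(\<alpha> - 0)\<^sup>2 + (\<beta> - 0)\<^sup>2 - (\<gamma> + 0)\<^sup>2 > 0" using assms by simp
  have "\<forall>\<^sub>F t in at_right (0::real). (0 < t \<and> t < \<alpha> \<and> t < \<beta>) \<and> (\<alpha> - t)\<^sup>2 + (\<beta> - t)\<^sup>2 - (\<gamma> + t)\<^sup>2 > 0"
    using assms order_tendstoD(1)[OF lim pos]
    by (intro eventually_conj) (auto intro: eventually_at_right_less eventually_at_right_field simp: eventually_at_right_field)
  then obtain t where "(0 < t \<and> t < \<alpha> \<and> t < \<beta>) \<and> (\<alpha> - t)\<^sup>2 + (\<beta> - t)\<^sup>2 - (\<gamma> + t)\<^sup>2 > 0"
    using eventually_happens'[OF trivial_limit_at_right_real] by blast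
  then show ?thesis by (intro exI[of _ t]) auto
qed

context coded_scalars begin

text \<open>\<open>presentation\<close> gives density with arbitrary scalar coefficients; these are
  replaced one by one by coded scalars.\<close>

lemma presentation_rational_approx:
  assumes "presentation X R" "X \<subseteq> ell2" "x \<in> X" "\<epsilon> > 0"
  shows "\<exists>m. ell2_norm (\<lambda>k. x k - rat_vec dec R m k) < \<epsilon>"
proof -
  have R: "R i \<in> ell2" for i using assms by (auto simp: presentation_def)
  have L: "(\<lambda>k. \<Sum>(c, i)\<leftarrow>cs. c * R i k) \<in> ell2" for cs :: "('a \<times> nat) list"
    by (induction cs) (auto intro!: ell2_zero ell2_add ell2_scale R)
  have approx: "\<exists>m. ell2_norm (\<lambda>k. (\<Sum>(c, i)\<leftarrow>cs. c * R i k) - rat_vec dec R m k) < \<epsilon>" if "\<epsilon> > 0" for \<epsilon> and cs :: "('a \<times> nat) list"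
    using that
  proof (induction cs arbitrary: \<epsilon>)
    case Nil
    then show ?case by (intro exI[of _ 0]) (simp add: rat_vec_def ell2_norm_def)
  next
    case (Cons ci cs)
    obtain c i where ci: "ci = (c, i)" by fastforce
    obtain m where m: "ell2_norm (\<lambda>k. (\<Sum>(c, i)\<leftarrow>cs. c * R i k) - rat_vec dec R m k) < \<epsilon> / 2"
      using Cons.IH[of "\<epsilon> / 2"] Cons.prems by auto
    \<comment> \<open>Adding 1 to the norm avoids division by zero when \<open>R i\<close>
      vanishes.\<close>
    have pos: "\<epsilon> / (2 * (ell2_norm (R i) + 1)) > 0" using Cons.prems ell2_norm_nonneg[OF R, of i] by auto
    then obtain a where a: "norm (dec a - c) < \<epsilon> / (2 * (ell2_norm (R i) + 1))"
      using dec_dense by blast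
    define m' where "m' = list_encode (prod_encode (a, i) # list_decode m)"
    have eq: "(\<lambda>k. (\<Sum>(c, i)\<leftarrow>ci # cs. c * R i k) - rat_vec dec R m' k) =
       (\<lambda>k. (c - dec a) * R i k + ((\<Sum>(c, i)\<leftarrow>cs. c * R i k) - rat_vec dec R m k))"
      unfolding m'_def rat_vec_list_encode_Cons ci by (auto simp: algebra_simps)
    have "ell2_norm (\<lambda>k. (c - dec a) * R i k) = norm (dec a - c) * ell2_norm (R i)"
      using ell2_scale(2)[OF R] by (simp add: norm_minus_commute)
    also have "\<dots> \<le> \<epsilon> / (2 * (ell2_norm (R i) + 1)) * ell2_norm (R i)"
      using a ell2_norm_nonneg[OF R, of i] by (intro mult_right_mono) auto
    also have "\<dots> \<le> \<epsilon> / 2"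
      using Cons.prems ell2_norm_nonneg[OF R, of i] by (simp add: field_simps)
    finally have "ell2_norm (\<lambda>k. (c - dec a) * R i k) \<le> \<epsilon> / 2" .
    moreover have "ell2_norm (\<lambda>k. (c - dec a) * R i k + ((\<Sum>(c, i)\<leftarrow>cs. c * R i k) - rat_vec dec R m k))
       \<le> ell2_norm (\<lambda>k. (c - dec a) * R i k) + ell2_norm (\<lambda>k. (\<Sum>(c, i)\<leftarrow>cs. c * R i k) - rat_vec dec R m k)"
      by (intro ell2_add(2) ell2_scale(1) R ell2_diff(1) L rat_vec_ell2)
    ultimately have "ell2_norm (\<lambda>k. (\<Sum>(c, i)\<leftarrow>ci # cs. c * R i k) - rat_vec dec R m' k) < \<epsilon>"
      unfolding eq using m by linarith
    then show ?case by blast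
  qed
  obtain cs where cs: "ell2_norm (\<lambda>k. x k - (\<Sum>(c, i)\<leftarrow>cs. c * R i k)) < \<epsilon> / 2"
    using assms(1,3,4) unfolding presentation_def by (meson half_gt_zero)
  obtain m where m: "ell2_norm (\<lambda>k. (\<Sum>(c, i)\<leftarrow>cs. c * R i k) - rat_vec dec R m k) < \<epsilon> / 2"
    using approx[of "\<epsilon> / 2" cs] assms(4) by auto
  have "ell2_norm (\<lambda>k. (x k - (\<Sum>(c, i)\<leftarrow>cs. c * R i k)) + ((\<Sum>(c, i)\<leftarrow>cs. c * R i k) - rat_vec dec R m k)) \<le>
    ell2_norm (\<lambda>k. x k - (\<Sum>(c, i)\<leftarrow>cs. c * R i k)) + ell2_norm (\<lambda>k. (\<Sum>(c, i)\<leftarrow>cs. c * R i k) - rat_vec dec R m k)"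
    using assms by (intro ell2_add(2) R ell2_diff(1) L rat_vec_ell2) auto
  then show ?thesis using cs m by (intro exI[of _ m]) simp
qed

text \<open>A finite certificate: an upper bound for the norm of the sum and lower bounds for the
  two norms already force obtuseness. The lower bounds must be nonnegative for their squares to be
  lower bounds.\<close>

definition certified_obtuse :: "(nat \<Rightarrow> nat) \<Rightarrow> nat \<Rightarrow> nat \<Rightarrow> nat \<Rightarrow> bool" where
  "certified_obtuse f t u v \<longleftrightarrow> (\<exists>a<t. \<exists>b<t. \<exists>c<t. pfst (f a) = u \<and> pfst (f b) = v \<and> pfst (f c) = code_append u v \<and>
     \<not> ivl_lo (f a) < 0 \<and> \<not> ivl_lo (f b) < 0 \<and>
     ivl_hi (f c) * ivl_hi (f c) < ivl_lo (f a) * ivl_lo (f a) + ivl_lo (f b) * ivl_lo (f b))"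

text \<open>The index \<open>a\<close> in \<open>J\<close> stands for dimension at least a + 1, of
  real dimension D = (a + 1) \<open>DIM('a)\<close>; the indices 0 to D give D + 1 vectors. The
  infinite-dimensional case asks this for every \<open>a\<close>.\<close>

definition spread :: "nat set \<Rightarrow> (nat \<Rightarrow> nat) \<Rightarrow> bool" where
  "spread J f \<longleftrightarrow> (\<forall>a\<in>J. \<exists>w t. \<forall>j<Suc (Suc a * DIM('a)). \<forall>i<j. certified_obtuse f t (code_nth w i) (code_nth w j))"

lemma certified_obtuse_iff:
  assumes R: "\<And>i. R i \<in> ell2" and f: "range f = diagram dec R"
  shows "(\<exists>t. certified_obtuse f t u v) \<longleftrightarrow>
     (ell2_norm (\<lambda>k. rat_vec dec R u k + rat_vec dec R v k))\<^sup>2 < (ell2_norm (rat_vec dec R u))\<^sup>2 + (ell2_norm (rat_vec dec R v))\<^sup>2"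
proof -
  define N where "N m = ell2_norm (rat_vec dec R m)" for m
  have f: "range f = cut_codes N" using f by (simp add: diagram_eq_cut_codes N_def[abs_def])
  have fN: "ivl_lo (f j) < N (pfst (f j))" "N (pfst (f j)) < ivl_hi (f j)" for j
    using rangeI[of f j] unfolding f cut_codes_def by auto
  have ex: "\<exists>j. pfst (f j) = m \<and> a < ivl_lo (f j) \<and> ivl_hi (f j) < b" if ab: "a < N m" "N m < b" for a b m
  proof -
    obtain x where "x \<in> cut_codes N" "pfst x = m" "a < ivl_lo x" "ivl_hi x < b"
      using cut_codes_exists[of a N m b] ab by blast
    then show ?thesis using f by (metis imageE)
  qed
  have N0: "N m \<ge> 0" for m unfolding N_def by (intro ell2_norm_nonneg rat_vec_ell2 R)
  have app: "(\<lambda>k. rat_vec dec R u k + rat_vec dec R v k) = rat_vec dec R (code_append u v)"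
    by (auto simp: rat_vec_code_append)
  show ?thesis unfolding app N_def[symmetric]
  proof
    assume "\<exists>t. certified_obtuse f t u v"
    then obtain a b c where abc: "pfst (f a) = u" "pfst (f b) = v" "pfst (f c) = code_append u v"
      "0 \<le> ivl_lo (f a)" "0 \<le> ivl_lo (f b)" "(ivl_hi (f c))\<^sup>2 < (ivl_lo (f a))\<^sup>2 + (ivl_lo (f b))\<^sup>2"
      unfolding certified_obtuse_def power2_eq_square not_less by blast
    have "(N (code_append u v))\<^sup>2 \<le> (ivl_hi (f c))\<^sup>2"
      using fN(2)[of c] N0 abc by (intro power_mono) auto
    moreover have "(ivl_lo (f a))\<^sup>2 \<le> (N u)\<^sup>2" "(ivl_lo (f b))\<^sup>2 \<le> (N v)\<^sup>2"
      using fN(1)[of a] fN(1)[of b] abc by (auto intro!: power_mono)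
    ultimately show "(N (code_append u v))\<^sup>2 < (N u)\<^sup>2 + (N v)\<^sup>2" using abc(6) by linarith
  next
    assume lt: "(N (code_append u v))\<^sup>2 < (N u)\<^sup>2 + (N v)\<^sup>2"
    have ru: "rat_vec dec R m \<in> ell2" for m by (intro rat_vec_ell2 R)
    have tri: "\<bar>N (code_append u v) - N u\<bar> \<le> N v" "\<bar>N (code_append u v) - N v\<bar> \<le> N u"
      using ell2_norm_diff_le[OF ru[of "code_append u v"] ru[of u]] ell2_norm_diff_le[OF ru[of "code_append u v"] ru[of v]]
      unfolding N_def by (simp_all add: rat_vec_code_append)
    \<comment> \<open>If one vector had norm 0, the triangle inequality would make the norm of the
      sum at least the other norm, contrary to \<open>lt\<close>.\<close>
    have "N u \<noteq> 0" "N v \<noteq> 0"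
      using tri lt N0 power_mono[of "N v" "N (code_append u v)" 2] power_mono[of "N u" "N (code_append u v)" 2]
      by (auto simp: not_le)
    then have "N u > 0" "N v > 0" using N0[of u] N0[of v] by linarith+
    from obtuse_perturbation[OF this lt] obtain t where t: "t > 0" "t < N u" "t < N v"
      "(N (code_append u v) + t)\<^sup>2 < (N u - t)\<^sup>2 + (N v - t)\<^sup>2" by blast
    obtain a where a: "pfst (f a) = u" "N u - t < ivl_lo (f a)" using ex[of "N u - t" u "N u + t"] t by auto
    obtain b where b: "pfst (f b) = v" "N v - t < ivl_lo (f b)" using ex[of "N v - t" v "N v + t"] t by auto
    obtain c where c: "pfst (f c) = code_append u v" "ivl_hi (f c) < N (code_append u v) + t"
      using ex[of "N (code_append u v) - t" "code_append u v" "N (code_append u v) + t"] t by auto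
    have "(ivl_hi (f c))\<^sup>2 \<le> (N (code_append u v) + t)\<^sup>2"
      using c fN(2)[of c] N0[of "code_append u v"] by (intro power_mono) auto
    moreover have "(N u - t)\<^sup>2 \<le> (ivl_lo (f a))\<^sup>2" "(N v - t)\<^sup>2 \<le> (ivl_lo (f b))\<^sup>2"
      using a b t by (auto intro!: power_mono)
    ultimately have "ivl_hi (f c) * ivl_hi (f c) < ivl_lo (f a) * ivl_lo (f a) + ivl_lo (f b) * ivl_lo (f b)"
      using t(4) unfolding power2_eq_square by linarith
    then have "certified_obtuse f (Suc (max a (max b c))) u v"
      unfolding certified_obtuse_def using a b c t by (intro exI[of _ a] exI[of _ b] exI[of _ c] conjI) auto
    then show "\<exists>t. certified_obtuse f t u v" by blast
  qed
qed

lemma certified_obtuse_mono: "certified_obtuse f t u v \<Longrightarrow> t \<le> t' \<Longrightarrow> certified_obtuse f t' u v"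
  unfolding certified_obtuse_def by (metis order_less_le_trans)

text \<open>An exact obtuse family exists in the first a + 1 coordinates, which belong to
  \<open>J\<close>. Density moves it to rational vectors without losing the strict inequalities, and
  finitely many certificates fit below a common bound t.\<close>

lemma presentation_spread:
  assumes J: "initial_segment J" and pres: "presentation (ell2_on J) R" and f: "range f = diagram dec R"
  shows "spread J f"
  unfolding spread_def
proof
  fix a assume a: "a \<in> J"
  define K where "K = Suc a * DIM('a)"
  have R: "R i \<in> ell2" for i using pres by (auto simp: presentation_def ell2_on_def)
  obtain x :: "nat \<Rightarrow> nat \<Rightarrow> 'a" where x: "\<And>j k. k \<ge> Suc a \<Longrightarrow> x j k = 0"
    "\<And>i j. i < j \<Longrightarrow> j \<le> K \<Longrightarrow> (\<Sum>k<Suc a. x i k \<bullet> x j k) < 0"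
    using exists_obtuse[of "Suc a"] unfolding K_def by blast
  have xe: "x j \<in> ell2" for j by (rule ell2_finite_support[of "Suc a"]) (rule x(1))
  have xJ: "x j \<in> ell2_on J" for j
  proof -
    have "x j k = 0" if "k \<notin> J" for k
      using J a that x(1)[of k j] unfolding initial_segment_def by (meson not_less_eq_eq)
    then show ?thesis using xe by (simp add: ell2_on_def)
  qed
  have "\<exists>m. ell2_norm (\<lambda>k. x j k - rat_vec dec R m k) < 1 / real (Suc q)" for j q
    by (rule presentation_rational_approx[OF pres _ xJ]) (auto simp: ell2_on_def)
  then obtain m where m: "\<And>j q. ell2_norm (\<lambda>k. x j k - rat_vec dec R (m j q) k) < 1 / real (Suc q)" by metis
  have re: "rat_vec dec R m \<in> ell2" for m by (intro rat_vec_ell2 R)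
  have lim0: "(\<lambda>q. 1 / real (Suc q)) \<longlonglongrightarrow> 0"
    using LIMSEQ_inverse_real_of_nat by (simp add: inverse_eq_divide)
  have lim1: "(\<lambda>q. ell2_norm (rat_vec dec R (m j q))) \<longlonglongrightarrow> ell2_norm (x j)" for j
  proof (rule tendsto_norm_bound[OF _ lim0], rule always_eventually, rule allI)
    fix q
    show "norm (ell2_norm (rat_vec dec R (m j q)) - ell2_norm (x j)) \<le> 1 / real (Suc q)"
      using ell2_norm_diff_le[OF xe[of j] re[of "m j q"]] m[of j q] by simp
  qed
  have lim2: "(\<lambda>q. ell2_norm (\<lambda>k. rat_vec dec R (m i q) k + rat_vec dec R (m j q) k)) \<longlonglongrightarrow> ell2_norm (\<lambda>k. x i k + x j k)" for i j
  proof (rule tendsto_norm_bound, rule always_eventually, rule allI)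
    fix q
    let ?d = "\<lambda>j k. x j k - rat_vec dec R (m j q) k"
    have "\<bar>ell2_norm (\<lambda>k. x i k + x j k) - ell2_norm (\<lambda>k. rat_vec dec R (m i q) k + rat_vec dec R (m j q) k)\<bar>
      \<le> ell2_norm (\<lambda>k. (x i k + x j k) - (rat_vec dec R (m i q) k + rat_vec dec R (m j q) k))"
      by (intro ell2_norm_diff_le ell2_add(1) xe re)
    also have "\<dots> = ell2_norm (\<lambda>k. ?d i k + ?d j k)" by (simp add: algebra_simps)
    also have "\<dots> \<le> ell2_norm (?d i) + ell2_norm (?d j)" by (intro ell2_add(2) ell2_diff(1) xe re)
    also have "\<dots> \<le> 1 / real (Suc q) + 1 / real (Suc q)" using m by (intro add_mono less_imp_le)
    finally show "norm (ell2_norm (\<lambda>k. rat_vec dec R (m i q) k + rat_vec dec R (m j q) k) - ell2_norm (\<lambda>k. x i k + x j k))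
      \<le> 1 / real (Suc q) + 1 / real (Suc q)" by (simp add: abs_minus_commute)
    show "(\<lambda>q. 1 / real (Suc q) + 1 / real (Suc q)) \<longlonglongrightarrow> 0"
      using tendsto_add[OF lim0 lim0] by simp
  qed
  have "\<forall>\<^sub>F q in sequentially. \<forall>j\<in>{..K}. \<forall>i\<in>{..<j}.
     (ell2_norm (\<lambda>k. rat_vec dec R (m i q) k + rat_vec dec R (m j q) k))\<^sup>2 <
     (ell2_norm (rat_vec dec R (m i q)))\<^sup>2 + (ell2_norm (rat_vec dec R (m j q)))\<^sup>2"
  proof (intro eventually_ball_finite ballI)
    fix j i assume "j \<in> {..K}" "i \<in> {..<j}"
    then have "(ell2_norm (\<lambda>k. x i k + x j k))\<^sup>2 - (ell2_norm (x i))\<^sup>2 - (ell2_norm (x j))\<^sup>2 < 0"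
      using x(2)[of i j] ell2_norm_square_add[of "Suc a" "x i" "x j"] x(1) by simp
    moreover have "(\<lambda>q. (ell2_norm (\<lambda>k. rat_vec dec R (m i q) k + rat_vec dec R (m j q) k))\<^sup>2 -
       (ell2_norm (rat_vec dec R (m i q)))\<^sup>2 - (ell2_norm (rat_vec dec R (m j q)))\<^sup>2) \<longlonglongrightarrow>
       (ell2_norm (\<lambda>k. x i k + x j k))\<^sup>2 - (ell2_norm (x i))\<^sup>2 - (ell2_norm (x j))\<^sup>2"
      by (intro tendsto_intros lim1 lim2)
    ultimately have "\<forall>\<^sub>F q in sequentially. (ell2_norm (\<lambda>k. rat_vec dec R (m i q) k + rat_vec dec R (m j q) k))\<^sup>2 -
       (ell2_norm (rat_vec dec R (m i q)))\<^sup>2 - (ell2_norm (rat_vec dec R (m j q)))\<^sup>2 < 0"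
      using order_tendstoD(2) by blast
    then show "\<forall>\<^sub>F q in sequentially. (ell2_norm (\<lambda>k. rat_vec dec R (m i q) k + rat_vec dec R (m j q) k))\<^sup>2 <
     (ell2_norm (rat_vec dec R (m i q)))\<^sup>2 + (ell2_norm (rat_vec dec R (m j q)))\<^sup>2"
      by eventually_elim linarith
  qed auto
  then obtain q where q: "\<And>i j. j \<le> K \<Longrightarrow> i < j \<Longrightarrow>
     (ell2_norm (\<lambda>k. rat_vec dec R (m i q) k + rat_vec dec R (m j q) k))\<^sup>2 <
     (ell2_norm (rat_vec dec R (m i q)))\<^sup>2 + (ell2_norm (rat_vec dec R (m j q)))\<^sup>2"
    by (auto simp: eventually_sequentially)
  define w where "w = list_encode (map (\<lambda>j. m j q) [0..<Suc K])"
  have w: "code_nth w j = m j q" if "j \<le> K" for j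
    using that by (simp add: w_def code_nth_def del: upt_Suc)
  have "\<forall>\<^sub>F t in sequentially. \<forall>j\<in>{..K}. \<forall>i\<in>{..<j}. certified_obtuse f t (code_nth w i) (code_nth w j)"
  proof (intro eventually_ball_finite ballI)
    fix j i assume "j \<in> {..K}" "i \<in> {..<j}"
    then obtain t where "certified_obtuse f t (code_nth w i) (code_nth w j)"
      using q[of j i] certified_obtuse_iff[OF R f, of "m i q" "m j q"] w by auto
    then show "\<forall>\<^sub>F t in sequentially. certified_obtuse f t (code_nth w i) (code_nth w j)"
      unfolding eventually_sequentially using certified_obtuse_mono by blast
  qed auto
  then obtain t where "\<forall>j\<in>{..K}. \<forall>i\<in>{..<j}. certified_obtuse f t (code_nth w i) (code_nth w j)"
    unfolding eventually_sequentially by blast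
  then show "\<exists>w t. \<forall>j<Suc (Suc a * DIM('a)). \<forall>i<j. certified_obtuse f t (code_nth w i) (code_nth w j)"
    unfolding K_def[symmetric] by (intro exI[of _ w] exI[of _ t]) (simp add: less_Suc_eq_le)
qed

text \<open>For the converse, the limit array has the right diagram but perhaps too small a span.
  Its triangular copy spans the space over some \<open>J'\<close> inside \<open>J\<close>, and
  \<open>spread\<close> forces equality.\<close>

lemma names_presentation_iff:
  assumes J: "initial_segment J"
  shows "names_presentation_of dec (ell2_on J) f \<longleftrightarrow>
     approximable J f \<and> shrinking f \<and> inward f \<and> outward f \<and> spread J f"
proof
  assume "names_presentation_of dec (ell2_on J) f"
  then obtain R where R: "presentation (ell2_on J) R" "range f = diagram dec R"
    unfolding names_presentation_of_def by blast
  show "approximable J f \<and> shrinking f \<and> inward f \<and> outward f \<and> spread J f"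
    using presentation_approximable[OF J R] presentation_spread[OF J R]
      range_eq_cut_codesD[OF R(2)[unfolded diagram_eq_cut_codes]] by blast
next
  assume *: "approximable J f \<and> shrinking f \<and> inward f \<and> outward f \<and> spread J f"
  then obtain R where triR: "triangular R" and R0: "\<And>i k. k \<notin> J \<Longrightarrow> R i k = 0" and
    bd: "\<And>j. ivl_lo (f j) \<le> ell2_norm (rat_vec dec R (pfst (f j)))"
    "\<And>j. ell2_norm (rat_vec dec R (pfst (f j))) \<le> ivl_hi (f j)"
    using approximable_limit[OF J, of f] by blast
  have fR: "range f = diagram dec R"
    unfolding diagram_eq_cut_codes using * bd by (intro range_eq_cut_codes_if) auto
  show "names_presentation_of dec (ell2_on J) f"
  proof (rule isometric_copy_in_segment[OF J triangular_ell2[OF triR] R0])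
    fix R' :: "nat \<Rightarrow> nat \<Rightarrow> 'a" and J'
    assume J': "initial_segment J'" "J' \<subseteq> J" and R': "triangular R'" "\<And>i k. k \<notin> J' \<Longrightarrow> R' i k = 0"
      and norm: "\<And>m. ell2_norm (rat_vec dec R' m) = ell2_norm (rat_vec dec R m)"
      and sp: "\<And>j. j \<in> J' \<Longrightarrow> (\<lambda>k. of_bool (k = j)) \<in> lspan R'"
    have fR': "range f = diagram dec R'" using fR unfolding diagram_eq_cut_codes norm .
    have "J \<subseteq> J'"
    proof
      fix a assume a: "a \<in> J"
      show "a \<in> J'"
      proof (rule ccontr)
        assume "a \<notin> J'"
        obtain w t where w: "\<And>i j. j < Suc (Suc a * DIM('a)) \<Longrightarrow> i < j \<Longrightarrow> certified_obtuse f t (code_nth w i) (code_nth w j)"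
          using * a unfolding spread_def by blast
        define u where "u i = rat_vec dec R' (code_nth w i)" for i
        have u0: "u i k = 0" if "k \<ge> a" for i k
        proof -
          have "k \<notin> J'" using J'(1) \<open>a \<notin> J'\<close> that unfolding initial_segment_def by blast
          then show ?thesis using R'(2) by (simp add: u_def rat_vec_eq_sum)
        qed
        have "(\<Sum>k<a. u i k \<bullet> u j k) < 0" if "i < j" "j \<le> Suc a * DIM('a)" for i j
        proof -
          have "(ell2_norm (\<lambda>k. u i k + u j k))\<^sup>2 < (ell2_norm (u i))\<^sup>2 + (ell2_norm (u j))\<^sup>2"
            using certified_obtuse_iff[OF triangular_ell2[OF R'(1)] fR', of "code_nth w i" "code_nth w j"] w[of j i] that
            unfolding u_def by auto
          then show ?thesis using ell2_norm_square_add[of a "u i" "u j"] u0 by simp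
        qed
        \<comment> \<open>All rational vectors of the copy live in the first \<open>a\<close>
          coordinates, but the obtuse family needs room for dimension a + 1.\<close>
        then have "Suc a * DIM('a) \<le> a * DIM('a)" by (rule obtuse_dim_le)
        then show False by simp
      qed
    qed
    then have "J' = J" using J'(2) by blast
    then have "presentation (ell2_on J) R'"
      using R' sp triangular_ell2[OF R'(1)] by (intro presentation_of_unit_vectors) (auto simp: ell2_on_def)
    then show ?thesis unfolding names_presentation_of_def using fR' by blast
  qed
qed

end

section \<open>Completeness\<close>

lemma ex_init_code_iff: "(\<exists>t. \<exists>j<t. P (code_nth (init_code f t) j)) \<longleftrightarrow> (\<exists>j. P (f j))"
  by (metis code_nth_init_code lessI)

text \<open>The integer code 2 stands for 1, and the denominator q + 1 is stored as q.\<close>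

lemma rat_dec_unit_fraction: "rat_dec (prod_encode (2, q)) = 1 / real (Suc q)"
  by (simp add: rat_dec_eq rat_pos_def rat_neg_def rat_den_def)

lemma Pi02_shrinking: "Pi02 {f. shrinking f}"
proof -
  define Q where "Q a (w::nat) s \<longleftrightarrow> (\<exists>j<code_length s. pfst (code_nth s j) = pfst a \<and>
     rat_dec (psnd (psnd (code_nth s j))) < rat_dec (rat_add (pfst (psnd (code_nth s j))) (prod_encode (2, psnd a))))"
    for a w s
  have "decidable3 Q" unfolding Q_def
    by (intro computable_intros decidable_rat_less computable_rat_arith computable_code_nth computable_code_length)
  from Pi02I[OF this] have "Pi02 {f. \<forall>a. \<exists>w t. Q a w (init_code f t)}" .
  moreover have "(\<exists>w t. Q a w (init_code f t)) \<longleftrightarrow>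
    (\<exists>j. pfst (f j) = pfst a \<and> ivl_hi (f j) < ivl_lo (f j) + 1 / real (Suc (psnd a)))" for a f
    unfolding Q_def ivl_lo_def ivl_hi_def code_length_init_code rat_dec_rat_add rat_dec_unit_fraction
    using ex_init_code_iff[of "\<lambda>x. pfst x = pfst a \<and> rat_dec (psnd (psnd x)) < rat_dec (pfst (psnd x)) + 1 / real (Suc (psnd a))" f]
    by simp
  moreover have "shrinking f \<longleftrightarrow> (\<forall>a. \<exists>j. pfst (f j) = pfst a \<and> ivl_hi (f j) < ivl_lo (f j) + 1 / real (Suc (psnd a)))" for f
    unfolding shrinking_def by (metis pfst_prod_encode psnd_prod_encode)
  ultimately show ?thesis by simp
qed

lemma Pi02_inward: "Pi02 {f. inward f}"
proof -
  define Q where "Q a (w::nat) s \<longleftrightarrow> a < code_length s \<and> w < code_length s \<and>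
     pfst (code_nth s w) = pfst (code_nth s a) \<and>
     rat_dec (pfst (psnd (code_nth s a))) < rat_dec (pfst (psnd (code_nth s w))) \<and>
     rat_dec (psnd (psnd (code_nth s w))) < rat_dec (psnd (psnd (code_nth s a)))" for a w s
  have "decidable3 Q" unfolding Q_def
    by (intro computable_intros decidable_rat_less computable_code_nth computable_code_length)
  from Pi02I[OF this] have "Pi02 {f. \<forall>a. \<exists>w t. Q a w (init_code f t)}" .
  moreover have "(\<exists>t. Q a w (init_code f t)) \<longleftrightarrow>
    pfst (f w) = pfst (f a) \<and> ivl_lo (f a) < ivl_lo (f w) \<and> ivl_hi (f w) < ivl_hi (f a)" for a w f
  proof -
    have "Q a w (init_code f t) \<longleftrightarrow> a < t \<and> w < t \<and>
       pfst (f w) = pfst (f a) \<and> ivl_lo (f a) < ivl_lo (f w) \<and> ivl_hi (f w) < ivl_hi (f a)" for t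
      by (auto simp: Q_def ivl_lo_def ivl_hi_def code_nth_init_code)
    moreover have "\<exists>t. a < t \<and> w < t" by (rule exI[of _ "Suc (max a w)"]) auto
    ultimately show ?thesis by auto
  qed
  ultimately show ?thesis unfolding inward_def by simp
qed

lemma Pi02_outward: "Pi02 {f. outward f}"
proof -
  define Q where "Q a (w::nat) s \<longleftrightarrow> pfst a < code_length s \<and> w < code_length s \<and>
     (rat_dec (pfst (psnd a)) < rat_dec (pfst (psnd (code_nth s (pfst a)))) \<and>
      rat_dec (psnd (psnd (code_nth s (pfst a)))) < rat_dec (psnd (psnd a)) \<longrightarrow>
     code_nth s w = prod_encode (pfst (code_nth s (pfst a)), psnd a))" for a w s
  have "decidable3 Q" unfolding Q_def
    by (intro computable_intros decidable_rat_less computable_code_nth computable_code_length)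
  from Pi02I[OF this] have "Pi02 {f. \<forall>a. \<exists>w t. Q a w (init_code f t)}" .
  moreover have "(\<exists>t. Q a w (init_code f t)) \<longleftrightarrow>
    (rat_dec (pfst (psnd a)) < ivl_lo (f (pfst a)) \<and> ivl_hi (f (pfst a)) < rat_dec (psnd (psnd a)) \<longrightarrow>
      f w = prod_encode (pfst (f (pfst a)), psnd a))" for a w f
  proof -
    have "Q a w (init_code f t) \<longleftrightarrow> pfst a < t \<and> w < t \<and>
      (rat_dec (pfst (psnd a)) < ivl_lo (f (pfst a)) \<and> ivl_hi (f (pfst a)) < rat_dec (psnd (psnd a)) \<longrightarrow>
      f w = prod_encode (pfst (f (pfst a)), psnd a))" for t
      by (auto simp: Q_def ivl_lo_def ivl_hi_def code_nth_init_code)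
    moreover have "\<exists>t. pfst a < t \<and> w < t" by (rule exI[of _ "Suc (max (pfst a) w)"]) auto
    ultimately show ?thesis by blast
  qed
  \<comment> \<open>The premise is moved inside the existential quantifier; it is decidable once
    \<open>f\<close> has been read up to the index \<open>pfst a\<close>.\<close>
  moreover have "outward f \<longleftrightarrow> (\<forall>a. \<exists>w. (rat_dec (pfst (psnd a)) < ivl_lo (f (pfst a)) \<and>
     ivl_hi (f (pfst a)) < rat_dec (psnd (psnd a)) \<longrightarrow> f w = prod_encode (pfst (f (pfst a)), psnd a)))" for f
    unfolding outward_def by (metis pfst_prod_encode psnd_prod_encode)
  ultimately show ?thesis by simp
qed

context coded_scalars begin

context
  fixes J :: "nat set"
  assumes decJ: "decidable (\<lambda>k. k \<in> J)"
begin

lemma Pi02_approximable: "Pi02 {f. approximable J f}"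
proof -
  \<comment> \<open>Fixing the length of the initial segment as \<open>a\<close> makes it list
    exactly the first \<open>a\<close> constraints.\<close>
  define Q where "Q a w s \<longleftrightarrow> code_length s = a \<and> (\<forall>j<code_length s.
     ell2_norm (rat_vec dec (\<lambda>i k. dec (entry_code J w i k)) (pfst (code_nth s j))) \<in> rat_interval (psnd (code_nth s j)))"
    for a w s
  have "triangular (\<lambda>i k. dec (entry_code J w i k))" for w
    using triangular_approximant[of J w] unfolding approximant_def[abs_def] .
  then have "decidable3 Q" unfolding Q_def entry_code_def
    by (intro computable_intros decidable_norm_in_rat_interval computable_code_nth computable_code_length
       decidable_comp[OF decJ])
  from Pi02I[OF this] have "Pi02 {f. \<forall>a. \<exists>w t. Q a w (init_code f t)}" .
  moreover have "(\<exists>w t. Q a w (init_code f t)) \<longleftrightarrow>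
    (\<exists>w. \<forall>j<a. ivl_lo (f j) < ell2_norm (rat_vec dec (approximant J w) (pfst (f j))) \<and>
      ell2_norm (rat_vec dec (approximant J w) (pfst (f j))) < ivl_hi (f j))" for a f
    unfolding Q_def by (auto simp: code_nth_init_code in_rat_interval approximant_def[abs_def] ivl_lo_def ivl_hi_def)
  ultimately show ?thesis unfolding approximable_def by simp
qed

lemma Pi02_spread: "Pi02 {f. spread J f}"
proof -
  \<comment> \<open>Decidability of \<open>J\<close> turns the quantifier over \<open>J\<close> into
    one over all numbers.\<close>
  define Q where "Q a w s \<longleftrightarrow> (a \<in> J \<longrightarrow> (\<forall>j<Suc (Suc a * DIM('a)). \<forall>i<j.
     certified_obtuse (code_nth s) (code_length s) (code_nth w i) (code_nth w j)))" for a w s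
  have cert: "certified_obtuse f t u v \<longleftrightarrow> (\<exists>a<t. \<exists>b<t. \<exists>c<t. pfst (f a) = u \<and> pfst (f b) = v \<and> pfst (f c) = code_append u v \<and>
     \<not> rat_dec (pfst (psnd (f a))) < rat_dec 0 \<and> \<not> rat_dec (pfst (psnd (f b))) < rat_dec 0 \<and>
     rat_dec (rat_mul (psnd (psnd (f c))) (psnd (psnd (f c)))) < rat_dec (rat_add
       (rat_mul (pfst (psnd (f a))) (pfst (psnd (f a)))) (rat_mul (pfst (psnd (f b))) (pfst (psnd (f b))))))" for f t u v
    by (simp add: certified_obtuse_def ivl_lo_def ivl_hi_def)
  have "decidable3 Q" unfolding Q_def cert
    by (intro computable_intros decidable_comp[OF decJ] decidable_rat_less computable_rat_arith
        computable_code_nth computable_code_length computable_code_append)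
  from Pi02I[OF this] have "Pi02 {f. \<forall>a. \<exists>w t. Q a w (init_code f t)}" .
  moreover have "certified_obtuse (code_nth (init_code f t)) t u v \<longleftrightarrow> certified_obtuse f t u v" for f t u v
    unfolding certified_obtuse_def by (intro ex_cong1 conj_cong refl) (simp_all add: code_nth_init_code)
  then have "(\<exists>w t. Q a w (init_code f t)) \<longleftrightarrow> (a \<in> J \<longrightarrow> (\<exists>w t. \<forall>j<Suc (Suc a * DIM('a)). \<forall>i<j.
     certified_obtuse f t (code_nth w i) (code_nth w j)))" for a f
    unfolding Q_def code_length_init_code by simp
  ultimately show ?thesis unfolding spread_def Ball_def by simp
qed

text \<open>\<open>R i\<close> reads \<open>i\<close> itself as a list of scalar codes. Its rational
  vectors have decidable norm comparisons, so the diagram is decidable and is enumerated by sending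
  every non-element to a fixed element.\<close>

lemma computable_name_exists:
  assumes J: "initial_segment J"
  obtains f0 where "computable f0" "names_presentation_of dec (ell2_on J) f0"
proof -
  define L where "L i k = (if k \<le> i \<and> k \<in> J then code_nth i k else 0)" for i k
  define R where "R i k = dec (L i k)" for i k
  have tri: "triangular R" by (auto simp: triangular_def R_def L_def dec_0)
  have "presentation (ell2_on J) R"
  proof (rule presentation_of_unit_vectors)
    show "R i \<in> ell2_on J" for i
      using triangular_ell2[OF tri] by (auto simp: ell2_on_def R_def L_def dec_0)
    fix j assume j: "j \<in> J"
    define l where "l = map (\<lambda>k. if k = j then cone else 0) [0..<Suc j]"
    have len: "length l = Suc j" by (simp add: l_def)
    \<comment> \<open>The truncation to coordinates k \<le> i thus leaves coordinate j of the list
      intact.\<close>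
    have "length l \<le> list_encode l" for l
      by (induction l) (auto intro: order_trans[OF _ le_prod_encode_2])
    from this[of l] have "j \<le> list_encode l" using len by simp
    then have "R (list_encode l) k = of_bool (k = j)" for k
      using j unfolding R_def L_def code_nth_def list_encode_inverse len
      by (cases "k < Suc j") (auto simp: l_def dec_0 dec_cone simp del: upt_Suc)
    then have "R (list_encode l) = (\<lambda>k. of_bool (k = j))" by blast
    then show "(\<lambda>k. of_bool (k = j)) \<in> lspan R" using lspan_base[of R "list_encode l"] by simp
  qed
  moreover obtain x0 where x0: "x0 \<in> diagram dec R"
    using infinite_cut_codes unfolding diagram_eq_cut_codes by (metis finite.emptyI ex_in_conv)
  define f0 where "f0 x = (if x \<in> diagram dec R then x else x0)" for x
  have "range f0 = diagram dec R" using x0 by (auto simp: f0_def)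
  moreover have "computable f0"
  proof -
    have mem: "x \<in> diagram dec R \<longleftrightarrow> ell2_norm (rat_vec dec (\<lambda>i k. dec (L i k)) (pfst x)) \<in> rat_interval (psnd x)" for x
      unfolding diagram_eq_cut_codes cut_codes_def in_rat_interval ivl_lo_def ivl_hi_def R_def[abs_def] by simp
    have t: "triangular (\<lambda>i k. dec (L i k))" using tri unfolding R_def[abs_def] .
    have "computable3 (\<lambda>x. L)" unfolding L_def
      by (intro computable_intros computable_code_nth decidable_comp[OF decJ])
    from decidable_norm_in_rat_interval[OF this t computable_pfst[OF computable_id] computable_psnd[OF computable_id]]
    show ?thesis unfolding f0_def mem by (intro computable_intros)
  qed
  ultimately show ?thesis using that unfolding names_presentation_of_def by blast
qed

theorem Pi02_complete_names_presentation:
  assumes J: "initial_segment J"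
  shows "Pi02_complete {f. names_presentation_of dec (ell2_on J) f}"
  unfolding Pi02_complete_def
proof (intro conjI allI impI)
  have "{f. names_presentation_of dec (ell2_on J) f} =
    {f. approximable J f} \<inter> ({f. shrinking f} \<inter> ({f. inward f} \<inter> ({f. outward f} \<inter> {f. spread J f})))"
    using names_presentation_iff[OF J] by blast
  then show "Pi02 {f. names_presentation_of dec (ell2_on J) f}"
    by (simp add: Pi02_Int Pi02_approximable Pi02_shrinking Pi02_inward Pi02_outward Pi02_spread)
  fix P assume "Pi02 P"
  obtain f0 where f0: "computable f0" "f0 \<in> {f. names_presentation_of dec (ell2_on J) f}"
    using computable_name_exists[OF J] by blast
  show "\<exists>F. computable_operator F \<and> (\<forall>f. f \<in> P \<longleftrightarrow> F f \<in> {f. names_presentation_of dec (ell2_on J) f})"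
  proof (rule Pi02_hardI[OF f0 _ _ \<open>Pi02 P\<close>])
    fix f assume "f \<in> {f. names_presentation_of dec (ell2_on J) f}"
    then show "infinite (range f)"
      using infinite_cut_codes unfolding names_presentation_of_def diagram_eq_cut_codes by auto
  next
    fix f g :: "nat \<Rightarrow> nat"
    assume "f \<in> {f. names_presentation_of dec (ell2_on J) f}" "range g = range f"
    then show "g \<in> {f. names_presentation_of dec (ell2_on J) f}"
      unfolding names_presentation_of_def by simp
  qed
qed

end

end

section \<open>The concrete spaces and the two scalar fields\<close>

lemma ell2_on_UNIV: "ell2_on UNIV = ell2"
  by (simp add: ell2_on_def)

lemma ell2_on_lessThan: "ell2_on {..<n} = ell2n n"
  unfolding ell2_on_def ell2n_def by (auto simp: not_less intro: ell2_finite_support)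

lemma initial_segment_UNIV: "initial_segment UNIV" and initial_segment_lessThan: "initial_segment {..<n}"
  by (auto simp: initial_segment_def)

lemma decidable_UNIV: "decidable (\<lambda>k. k \<in> UNIV)" and decidable_lessThan: "decidable (\<lambda>k. k \<in> {..<n})"
  unfolding UNIV_def lessThan_def mem_Collect_eq decidable_def[of "\<lambda>_. True"]
  by (intro computable_intros)+

text \<open>The code of 1 pairs the integer code 2, which stands for 1, with the stored denominator
  0, which stands for 1.\<close>

lemma coded_scalars_real:
  "coded_scalars rat_dec rat_add rat_mul (\<lambda>a. rat_mul a a) (prod_encode (2, 0)) (\<lambda>x. x)"
proof
  show "computable2 rat_add" "computable2 rat_mul" "computable (\<lambda>a. rat_mul a a)"
    by (intro computable_intros computable_rat_arith)+
  show "rat_dec (prod_encode (2, 0)) = 1"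
    by (simp add: rat_dec_eq rat_pos_def rat_neg_def rat_den_def)
qed (use rat_dec_dense in \<open>auto simp: power2_eq_square\<close>)

lemma coded_scalars_complex:
  "coded_scalars crat_dec crat_add crat_mul crat_nsq (prod_encode (prod_encode (2, 0), 0)) cnj"
proof
  show "crat_dec (prod_encode (prod_encode (2, 0), 0)) = 1"
    by (simp add: crat_dec_eq rat_dec_eq rat_pos_def rat_neg_def rat_den_def complex_eq_iff)
  show "\<exists>c. norm (crat_dec c - x) < \<epsilon>" if \<epsilon>: "\<epsilon> > 0" for x \<epsilon>
  proof -
    obtain a b where "norm (rat_dec a - Re x) < \<epsilon> / 2" "norm (rat_dec b - Im x) < \<epsilon> / 2"
      using rat_dec_dense[of "\<epsilon> / 2"] \<epsilon> by (meson half_gt_zero)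
    then have "norm (crat_dec (prod_encode (a, b)) - x) < \<epsilon>"
      using cmod_le[of "crat_dec (prod_encode (a, b)) - x"] by (simp add: crat_dec_eq)
    then show ?thesis by blast
  qed
  show "x * cnj x = of_real ((norm x)\<^sup>2)" for x by (simp only: complex_norm_square)
  show "crat_dec 0 = 0" by (simp add: crat_dec_eq complex_eq_iff)
qed (use computable_crat_arith in auto)

theorem theorem5p2:
  shows "Pi02_complete {f. names_presentation_of rat_dec (ell2 :: (nat \<Rightarrow> real) set) f}
       \<and> (\<forall>n\<ge>1. Pi02_complete {f. names_presentation_of rat_dec (ell2n n :: (nat \<Rightarrow> real) set) f})
       \<and> Pi02_complete {f. names_presentation_of crat_dec (ell2 :: (nat \<Rightarrow> complex) set) f}
       \<and> (\<forall>n\<ge>1. Pi02_complete {f. names_presentation_of crat_dec (ell2n n :: (nat \<Rightarrow> complex) set) f})"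
  using coded_scalars.Pi02_complete_names_presentation[OF coded_scalars_real decidable_UNIV initial_segment_UNIV]
    coded_scalars.Pi02_complete_names_presentation[OF coded_scalars_real decidable_lessThan initial_segment_lessThan]
    coded_scalars.Pi02_complete_names_presentation[OF coded_scalars_complex decidable_UNIV initial_segment_UNIV]
    coded_scalars.Pi02_complete_names_presentation[OF coded_scalars_complex decidable_lessThan initial_segment_lessThan]
  unfolding ell2_on_UNIV ell2_on_lessThan by blast

end
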